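(* Let $E$ and $F$ be two Banach lattices such that $E'$ and $F$ have order continuous norms. Then every positive disjoint weak$^{\star}$ Dunford-Pettis operator $T:E\to F$ is M-weakly compact (hence uaw-Dunford-Pettis).
   Context: "Operator" means bounded linear map; $E'$ is the dual of $E$. An operator $T:E\to Y$ from a Banach lattice $E$ into a Banach space $Y$ is disjoint weak$^{\star}$ Dunford-Pettis if $\lim_{n\to\infty} f_n(Tx_n)=0$ for every norm bounded disjoint sequence $(x_n)$ in $E$ and every weak$^{\star}$ null sequence $(f_n)$ in $Y'$. $T$ is M-weakly compact if $\|Tx_n\|\to0$ for every norm bounded disjoint sequence $(x_n)$ in $E$. A sequence $(x_n)$ in $E$ is uaw-convergent to $x\in E$, written $x_n\overset{uaw}{\longrightarrow}x$, if $|x_n-x|\wedge u\to0$ weakly for every $u\in E^+$. $T$ is uaw-Dunford-Pettis if $\|Tx_n\|\to0$ for every norm bounded sequence $(x_n)$ in $E$ with $x_n\overset{uaw}{\longrightarrow}0$. *)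

theory Defs
  imports "HOL-Analysis.Analysis" "HOL-Library.Lattice_Algebras"
begin

class banach_lattice = banach + ordered_real_vector + lattice_ab_group_add_abs +
  assumes norm_lattice_mono: "\<bar>x\<bar> \<le> \<bar>y\<bar> \<Longrightarrow> norm x \<le> norm y"

instance real :: banach_lattice
  by standard simp

text \<open>
  Operators are elements of \<^typ>\<open>'a \<Rightarrow>\<^sub>L 'b\<close>, and the dual of \<^typ>\<open>'a\<close> is \<^typ>\<open>'a \<Rightarrow>\<^sub>L real\<close> with the
  operator norm. Operators between Banach lattices are ordered by the cone of positive
  operators, so that \<open>0 \<le> T\<close> says that \<open>T\<close> is positive; on the dual this is the usual order.
\<close>

instantiation blinfun :: (banach_lattice, banach_lattice) order
begin

definition less_eq_blinfun :: "('a \<Rightarrow>\<^sub>L 'b) \<Rightarrow> ('a \<Rightarrow>\<^sub>L 'b) \<Rightarrow> bool" where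
  "S \<le> T \<longleftrightarrow> (\<forall>x\<ge>0. blinfun_apply S x \<le> blinfun_apply T x)"

definition less_blinfun :: "('a \<Rightarrow>\<^sub>L 'b) \<Rightarrow> ('a \<Rightarrow>\<^sub>L 'b) \<Rightarrow> bool" where
  "S < T \<longleftrightarrow> S \<le> T \<and> \<not> T \<le> (S :: 'a \<Rightarrow>\<^sub>L 'b)"

instance
proof
  fix R S T :: "'a \<Rightarrow>\<^sub>L 'b"
  show "S < T \<longleftrightarrow> S \<le> T \<and> \<not> T \<le> S"
    by (rule less_blinfun_def)
  show "S \<le> S"
    by (simp add: less_eq_blinfun_def)
  show "R \<le> T" if "R \<le> S" "S \<le> T"
    using that unfolding less_eq_blinfun_def by (meson order_trans)
  show "S = T" if "S \<le> T" "T \<le> S"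
  proof (rule blinfun_eqI)
    fix x :: 'a
    have pos: "blinfun_apply S y = blinfun_apply T y" if "0 \<le> y" for y
      using \<open>S \<le> T\<close> \<open>T \<le> S\<close> that unfolding less_eq_blinfun_def by (meson order_antisym)
    have "x = \<bar>x\<bar> - (\<bar>x\<bar> - x)" "0 \<le> \<bar>x\<bar>" "0 \<le> \<bar>x\<bar> - x"
      by (simp_all add: abs_ge_self)
    then show "blinfun_apply S x = blinfun_apply T x"
      using pos by (metis blinfun.diff_right)
  qed
qed

end

instance blinfun :: (banach_lattice, banach_lattice) ordered_ab_group_add
  by standard (simp add: less_eq_blinfun_def plus_blinfun.rep_eq)

lemma zero_le_blinfun_iff:
  "0 \<le> (T :: 'a::banach_lattice \<Rightarrow>\<^sub>L 'b::banach_lattice) \<longleftrightarrow> (\<forall>x\<ge>0. 0 \<le> blinfun_apply T x)"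
  by (simp add: less_eq_blinfun_def)

text \<open>
  The norm is order continuous if \<open>\<parallel>x\<^sub>\<alpha>\<parallel> \<rightarrow> 0\<close> for every decreasing net \<open>x\<^sub>\<alpha>\<close> with infimum \<open>0\<close>. The
  range of such a net is a downward directed set with infimum \<open>0\<close>, every such set is a
  decreasing net indexed by itself, and since the norm is monotone on the positive cone the net
  of norms converges to its infimum. Stating it this way needs only the order, so that it
  applies directly to the dual.
\<close>

definition order_continuous_norm :: "'a::{order, real_normed_vector} itself \<Rightarrow> bool" where
  "order_continuous_norm (_ :: 'a itself) \<longleftrightarrow>
    (\<forall>D :: 'a set. D \<noteq> {} \<and>
      (\<forall>x\<in>D. \<forall>y\<in>D. \<exists>z\<in>D. z \<le> x \<and> z \<le> y) \<and>
      (\<forall>x\<in>D. 0 \<le> x) \<and> (\<forall>l. (\<forall>x\<in>D. l \<le> x) \<longrightarrow> l \<le> 0)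
      \<longrightarrow> (INF x\<in>D. norm x) = 0)"

definition disjoint_seq :: "(nat \<Rightarrow> 'a::banach_lattice) \<Rightarrow> bool" where
  "disjoint_seq x \<longleftrightarrow> (\<forall>m n. m \<noteq> n \<longrightarrow> inf \<bar>x m\<bar> \<bar>x n\<bar> = 0)"

definition weak_star_null :: "(nat \<Rightarrow> 'a::real_normed_vector \<Rightarrow>\<^sub>L real) \<Rightarrow> bool" where
  "weak_star_null f \<longleftrightarrow> (\<forall>y. (\<lambda>n. blinfun_apply (f n) y) \<longlonglongrightarrow> 0)"

definition weakly_null :: "(nat \<Rightarrow> 'a::real_normed_vector) \<Rightarrow> bool" where
  "weakly_null x \<longleftrightarrow> (\<forall>f :: 'a \<Rightarrow>\<^sub>L real. (\<lambda>n. blinfun_apply f (x n)) \<longlonglongrightarrow> 0)"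

definition uaw_converges :: "(nat \<Rightarrow> 'a::banach_lattice) \<Rightarrow> 'a \<Rightarrow> bool" where
  "uaw_converges x l \<longleftrightarrow> (\<forall>u\<ge>0. weakly_null (\<lambda>n. inf \<bar>x n - l\<bar> u))"

definition disjoint_weak_star_dunford_pettis ::
    "('a::banach_lattice \<Rightarrow>\<^sub>L 'b::banach) \<Rightarrow> bool" where
  "disjoint_weak_star_dunford_pettis T \<longleftrightarrow>
    (\<forall>x f. bounded (range x) \<and> disjoint_seq x \<and> weak_star_null f
      \<longrightarrow> (\<lambda>n. blinfun_apply (f n) (blinfun_apply T (x n))) \<longlonglongrightarrow> 0)"

definition M_weakly_compact :: "('a::banach_lattice \<Rightarrow>\<^sub>L 'b::banach) \<Rightarrow> bool" where
  "M_weakly_compact T \<longleftrightarrow>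
    (\<forall>x. bounded (range x) \<and> disjoint_seq x \<longrightarrow> (\<lambda>n. norm (blinfun_apply T (x n))) \<longlonglongrightarrow> 0)"

definition uaw_dunford_pettis :: "('a::banach_lattice \<Rightarrow>\<^sub>L 'b::banach) \<Rightarrow> bool" where
  "uaw_dunford_pettis T \<longleftrightarrow>
    (\<forall>x. bounded (range x) \<and> uaw_converges x 0 \<longrightarrow> (\<lambda>n. norm (blinfun_apply T (x n))) \<longlonglongrightarrow> 0)"

end

theory Submission
  imports Defs
begin

text \<open>
  Since the norm of \<open>E'\<close> is order continuous, bounded disjoint positive sequences in \<open>E\<close> are weakly
  null: the components of a positive functional on the bands generated by \<open>x\<^sub>1 + \<dots> + x\<^sub>N\<close> increase
  to a supremum, hence converge in norm. So \<open>y\<^sub>n = T x\<^sub>n\<close> is positive and weakly null, and \<open>y\<^sub>n \<and> w\<close>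
  tends to \<open>0\<close> in norm for every \<open>w \<ge> 0\<close>, as the norm of \<open>F\<close> is order continuous. If \<open>\<parallel>y\<^sub>n\<parallel>\<close> does not
  tend to \<open>0\<close>, then a subsequence of \<open>y\<close> is, up to null sequences, a disjoint sequence \<open>z\<close>; norming
  functionals carried by the bands generated by the \<open>z\<^sub>k\<close> form a weak-star null sequence on which
  the disjoint weak-star Dunford-Pettis property fails. The same subsequence argument, applied in
  \<open>E\<close>, reduces a uaw-null sequence to a disjoint one up to an order bounded part.
\<close>

subsection \<open>Lattice inequalities in Banach lattices\<close>

text \<open>Translation invariance gives \<open>sup x y = pprt (x - y) + y\<close>, and
  \<open>x + y\<close> is the sum of infimum and supremum. Later this splits an element into a
  truncation and the excess over the truncation level.\<close>

lemma inf_eq_diff_pprt: "inf x y = x - pprt (x - y)" for x y :: "'a::lattice_ab_group_add"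
proof -
  have "sup x y = pprt (x - y) + y"
    by (simp add: pprt_def add_sup_distrib_right)
  then show ?thesis
    using add_eq_inf_sup[of x y] by (simp add: algebra_simps del: diff_sup_eq_inf)
qed

text \<open>Since addition distributes over infima, the right-hand side is the infimum of
  \<open>a + b\<close>, \<open>a + c\<close>, \<open>c + b\<close> and \<open>c + c\<close>, each of
  which dominates \<open>inf (a + b) c\<close>.\<close>

lemma inf_add_le: "inf (a + b) c \<le> inf a c + inf b c"
  if "0 \<le> a" "0 \<le> b" "0 \<le> c" for a b c :: "'a::lattice_ab_group_add"
proof -
  have "c \<le> a + c" "c \<le> c + b" "c \<le> c + c"
    using that by simp_all
  then have "inf (a + b) c \<le> a + c" "inf (a + b) c \<le> c + b" "inf (a + b) c \<le> c + c"
    by (simp_all add: le_infI2)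
  then show ?thesis
    unfolding add_inf_distrib_right add_inf_distrib_left by (simp add: le_infI1)
qed

lemma inf_scaleR: "inf (t *\<^sub>R x) (t *\<^sub>R y) = t *\<^sub>R inf x y" if "0 < t"
  for x y :: "'a::banach_lattice"
proof (rule antisym)
  show "inf (t *\<^sub>R x) (t *\<^sub>R y) \<le> t *\<^sub>R inf x y"
  proof -
    let ?w = "inf (t *\<^sub>R x) (t *\<^sub>R y)"
    have "inverse t *\<^sub>R ?w \<le> inverse t *\<^sub>R (t *\<^sub>R x)" "inverse t *\<^sub>R ?w \<le> inverse t *\<^sub>R (t *\<^sub>R y)"
      using that by (intro scaleR_left_mono; simp)+
    with that have "inverse t *\<^sub>R ?w \<le> inf x y"
      by simp
    from scaleR_left_mono[OF this, of t] that show ?thesis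
      by simp
  qed
  show "t *\<^sub>R inf x y \<le> inf (t *\<^sub>R x) (t *\<^sub>R y)"
    using that by (simp add: scaleR_left_mono)
qed

lemma inf_scaleR_eq_0: "inf (s *\<^sub>R x) (t *\<^sub>R y) = 0"
  if "0 \<le> s" "0 \<le> t" "0 \<le> x" "0 \<le> y" "inf x y = 0" for x y :: "'a::banach_lattice"
proof (rule antisym)
  \<comment> \<open>The common factor \<open>s + t + 1\<close> is positive even if both scalars
    vanish, so \<open>inf_scaleR\<close> applies.\<close>
  have "inf (s *\<^sub>R x) (t *\<^sub>R y) \<le> inf ((s + t + 1) *\<^sub>R x) ((s + t + 1) *\<^sub>R y)"
    using that by (intro inf_mono scaleR_right_mono) auto
  also have "\<dots> = 0"
    using that by (simp add: inf_scaleR)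
  finally show "inf (s *\<^sub>R x) (t *\<^sub>R y) \<le> 0" .
  show "0 \<le> inf (s *\<^sub>R x) (t *\<^sub>R y)"
    using that by (simp add: scaleR_nonneg_nonneg)
qed

lemma norm_mono: "norm x \<le> norm y" if "0 \<le> x" "x \<le> y" for x y :: "'a::banach_lattice"
  using that by (intro norm_lattice_mono) simp

lemma norm_abs_lattice [simp]: "norm \<bar>x\<bar> = norm x" for x :: "'a::banach_lattice"
  by (intro antisym norm_lattice_mono) simp_all

lemma pprt_le_abs: "pprt x \<le> \<bar>x\<bar>" for x :: "'a::lattice_ab_group_add_abs"
  by (simp add: pprt_def abs_ge_self)

lemma norm_pprt_le: "norm (pprt x) \<le> norm x" for x :: "'a::banach_lattice"
  using norm_mono[OF zero_le_pprt pprt_le_abs, of x] by simp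

lemma pprt_add_le: "pprt (x + y) \<le> pprt x + pprt y" for x y :: "'a::lattice_ab_group_add"
proof -
  have "x + y \<le> pprt x + pprt y"
    by (intro add_mono) (simp_all add: pprt_def)
  then show ?thesis
    by (simp add: pprt_def[of "x + y"] add_nonneg_nonneg)
qed

text \<open>The negative part \<open>pprt (- l)\<close> lies below \<open>pprt (X n - l)\<close>,
  whose norm tends to 0; so the positive cone is closed.\<close>

lemma nonneg_LIMSEQ: "0 \<le> l" if "X \<longlonglongrightarrow> l" "\<And>n. 0 \<le> X n"
  for X :: "nat \<Rightarrow> 'a::banach_lattice"
proof -
  have "norm (pprt (- l)) \<le> norm (X n - l)" for n
  proof (rule order_trans[OF norm_mono norm_pprt_le])
    show "pprt (- l) \<le> pprt (X n - l)"
      using that(2)[of n] by (intro pprt_mono) simp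
  qed simp
  moreover have "(\<lambda>n. norm (X n - l)) \<longlonglongrightarrow> 0"
    using that(1) by (simp add: LIM_zero_iff tendsto_norm_zero_iff)
  ultimately have "norm (pprt (- l)) \<le> 0"
    by (intro LIMSEQ_le_const) auto
  then have "pprt (- l) = 0"
    by simp
  then show ?thesis
    by (simp flip: le_zero_iff_zero_pprt)
qed

lemma LIMSEQ_lattice_mono: "l \<le> m" if "X \<longlonglongrightarrow> l" "Y \<longlonglongrightarrow> m" "\<And>n. X n \<le> Y n"
  for X :: "nat \<Rightarrow> 'a::banach_lattice"
  using nonneg_LIMSEQ[OF tendsto_diff[OF that(2,1)]] that(3) by simp

text \<open>Division by \<open>Suc k\<close> bounds \<open>l\<close> by a null sequence, and the
  order is preserved under limits.\<close>

lemma archimedean_lattice: "l \<le> 0" if "\<And>k::nat. real k *\<^sub>R l \<le> u" for l u :: "'a::banach_lattice"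
proof -
  have "l \<le> inverse (real (Suc k)) *\<^sub>R u" for k
    using scaleR_left_mono[OF that[of "Suc k"], of "inverse (real (Suc k))"] by simp
  moreover have "(\<lambda>k. inverse (real (Suc k)) *\<^sub>R u) \<longlonglongrightarrow> 0 *\<^sub>R u"
    by (intro tendsto_intros LIMSEQ_inverse_real_of_nat)
  ultimately show ?thesis
    using LIMSEQ_lattice_mono[OF tendsto_const] by auto
qed

lemma pprt_scaleR: "pprt (t *\<^sub>R x) = t *\<^sub>R pprt x" if "0 < t" for x :: "'a::banach_lattice"
  using inf_scaleR[OF that, of "- x" 0] by (simp add: pprt_def sup_eq_neg_inf del: neg_inf_eq_sup)

lemma inf_pprt_pprt_minus: "inf (pprt x) (pprt (- x)) = 0" for x :: "'a::lattice_ab_group_add"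
proof -
  have "pprt x - pprt (- x) = x"
    using prts[of x] by (simp add: pprt_neg)
  then show ?thesis
    by (simp add: inf_eq_diff_pprt)
qed

lemma inf_sum_eq_0: "inf (\<Sum>i\<in>I. v i) w = 0"
  if "finite I" "\<And>i. i \<in> I \<Longrightarrow> 0 \<le> v i" "\<And>i. i \<in> I \<Longrightarrow> inf (v i) w = 0" "0 \<le> w"
  for v :: "'i \<Rightarrow> 'a::lattice_ab_group_add"
  using that
proof (induction I rule: finite_induct)
  case (insert i I)
  have nonneg: "0 \<le> (\<Sum>i\<in>I. v i)"
    using insert.prems by (intro sum_nonneg) simp
  have "inf (\<Sum>i\<in>insert i I. v i) w \<le> inf (v i) w + inf (\<Sum>i\<in>I. v i) w"
    using inf_add_le[of "v i" "\<Sum>i\<in>I. v i" w] insert.prems insert.hyps nonneg by simp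
  also have "\<dots> = 0"
    using insert by simp
  finally show ?case
    using insert nonneg by (intro antisym) (simp_all add: add_nonneg_nonneg)
qed (simp add: inf_absorb1)

text \<open>Each partial sum is disjoint from the next term, so adding that term amounts to taking a
  supremum, which \<open>u\<close> still bounds.\<close>

lemma sum_disjoint_le: "(\<Sum>i<n. v i) \<le> u"
  if v: "\<And>i. 0 \<le> v i" "\<And>i. v i \<le> u" "\<And>i j. i \<noteq> j \<Longrightarrow> inf (v i) (v j) = 0"
  for v :: "nat \<Rightarrow> 'a::lattice_ab_group_add"
proof (induction n)
  case 0
  show ?case using order_trans[OF v(1,2)] by simp
next
  case (Suc n)
  have "inf (\<Sum>i<n. v i) (v n) = 0"
    by (intro inf_sum_eq_0) (simp_all add: v)
  then have "(\<Sum>i<Suc n. v i) = sup (\<Sum>i<n. v i) (v n)"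
    using add_eq_inf_sup[of "\<Sum>i<n. v i" "v n"] by simp
  with Suc v(2) show ?case
    by simp
qed

subsection \<open>Order continuous norms\<close>

text \<open>An element of small norm replaces the infimum of the norms. The type carries only an
  order and a norm, so that the rule also serves for the dual, on which no lattice operations are
  defined here.\<close>

lemma order_continuous_norm_small:
  fixes D :: "'a::{order, real_normed_vector} set"
  assumes "order_continuous_norm TYPE('a)" "D \<noteq> {}"
    and "\<And>x y. x \<in> D \<Longrightarrow> y \<in> D \<Longrightarrow> \<exists>z\<in>D. z \<le> x \<and> z \<le> y"
    and "\<And>x. x \<in> D \<Longrightarrow> 0 \<le> x" "\<And>l. (\<And>x. x \<in> D \<Longrightarrow> l \<le> x) \<Longrightarrow> l \<le> 0" "0 < e"
  shows "\<exists>x\<in>D. norm x < e"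
proof -
  have "(INF x\<in>D. norm x) = 0"
    by (rule assms(1)[unfolded order_continuous_norm_def, rule_format])
      (intro conjI ballI allI impI; (rule assms; assumption)?; use assms in simp)
  moreover have "bdd_below (norm ` D)"
    by (rule bdd_belowI2[of _ 0]) simp
  ultimately show ?thesis
    using cINF_less_iff[of D norm e] assms by auto
qed

text \<open>No supremum of \<open>s\<close> is known to exist, so order continuity is applied to the
  differences between upper bounds of \<open>s\<close> and its terms. They form a downward directed
  set with infimum 0, and one small difference controls a whole tail of \<open>s\<close>.\<close>

lemma order_continuous_norm_Cauchy:
  fixes s :: "nat \<Rightarrow> 'a::banach_lattice"
  assumes oc: "order_continuous_norm TYPE('a)" and s: "incseq s" "\<And>n. s n \<le> u"
  shows "convergent s"
proof -
  define D where "D = {w - s n | w n. \<forall>m. s m \<le> w}"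
  have small: "\<exists>x\<in>D. norm x < e" if "e > 0" for e
  proof (rule order_continuous_norm_small[OF oc _ _ _ _ that])
    show "D \<noteq> {}"
      using s(2) by (auto simp: D_def)
    show "\<exists>z\<in>D. z \<le> x \<and> z \<le> y" if xy: "x \<in> D" "y \<in> D" for x y
    proof -
      from xy obtain w n w' n' where *: "x = w - s n" "\<forall>m. s m \<le> w" "y = w' - s n'" "\<forall>m. s m \<le> w'"
        by (auto simp: D_def)
      have "s n \<le> s (max n n')" "s n' \<le> s (max n n')"
        using s(1) by (auto simp: incseq_def)
      then have "inf w w' - s (max n n') \<le> x" "inf w w' - s (max n n') \<le> y"
        unfolding * by (intro diff_mono; simp)+
      moreover have "inf w w' - s (max n n') \<in> D"
        using * by (force simp: D_def)
      ultimately show ?thesis by blast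
    qed
    show "0 \<le> x" if "x \<in> D" for x
      using that by (auto simp: D_def)
    show "l \<le> 0" if l: "\<And>x. x \<in> D \<Longrightarrow> l \<le> x" for l
    proof (rule archimedean_lattice)
      \<comment> \<open>If \<open>w\<close> bounds \<open>s\<close>, then
        \<open>l \<le> w - s m\<close> for all \<open>m\<close> says that \<open>w - l\<close>
        bounds \<open>s\<close> as well. Starting from \<open>u\<close>, this is iterated
        \<open>k\<close> times.\<close>
      have *: "\<forall>m. s m \<le> u - real k *\<^sub>R l" for k
      proof (induction k)
        case (Suc k)
        then have "l \<le> (u - real k *\<^sub>R l) - s m" for m
          by (intro l) (auto simp: D_def)
        then show ?case
          by (simp add: algebra_simps)
      qed (use s(2) in simp)
      then show "real k *\<^sub>R l \<le> u - s 0" for k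
        using *[of k] by (simp add: algebra_simps)
    qed
  qed
  have "Cauchy s"
  proof (rule CauchyI')
    fix e :: real assume "e > 0"
    from small[OF this] obtain w M where w: "\<forall>m. s m \<le> w" "norm (w - s M) < e"
      by (auto simp: D_def)
    have "norm (s n - s m) < e" if "m \<ge> M" "m < n" for m n
    proof (rule le_less_trans[OF norm_mono w(2)])
      show "0 \<le> s n - s m"
        using s(1) that by (simp add: incseq_def)
      show "s n - s m \<le> w - s M"
        using w(1) s(1) that by (intro diff_mono) (auto simp: incseq_def)
    qed
    then show "\<exists>M. \<forall>m\<ge>M. \<forall>n>m. dist (s m) (s n) < e"
      by (auto simp: dist_norm norm_minus_commute)
  qed
  then show ?thesis
    by (simp add: Cauchy_convergent_iff)
qed

text \<open>The partial sums increase and stay below \<open>u\<close>, so the series converges and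
  its terms are null.\<close>

lemma order_bounded_disjoint_null:
  fixes v :: "nat \<Rightarrow> 'a::banach_lattice"
  assumes oc: "order_continuous_norm TYPE('a)"
    and v: "\<And>i. 0 \<le> v i" "\<And>i. v i \<le> u" "\<And>i j. i \<noteq> j \<Longrightarrow> inf (v i) (v j) = 0"
  shows "v \<longlonglongrightarrow> 0"
proof -
  have "convergent (\<lambda>n. \<Sum>i<n. v i)"
    using v by (intro order_continuous_norm_Cauchy[OF oc _ sum_disjoint_le])
      (auto intro: incseq_SucI)
  then show ?thesis
    by (intro summable_LIMSEQ_zero) (simp add: summable_iff_convergent)
qed

subsection \<open>Norming positive functionals\<close>

definition sublinear :: "('a::real_vector \<Rightarrow> real) \<Rightarrow> bool" where
  "sublinear q \<longleftrightarrow> (\<forall>x y. q (x + y) \<le> q x + q y) \<and> (\<forall>x. \<forall>t>0. q (t *\<^sub>R x) \<le> t * q x)"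

lemma sublinear_add: "sublinear q \<Longrightarrow> q (x + y) \<le> q x + q y"
  and sublinear_scale: "sublinear q \<Longrightarrow> t > 0 \<Longrightarrow> q (t *\<^sub>R x) \<le> t * q x"
  by (auto simp: sublinear_def)


lemma sublinear_scale_eq: "q (t *\<^sub>R x) = t * q x" if q: "sublinear q" and "0 \<le> t"
proof (cases "t = 0")
  case True
  \<comment> \<open>The factor 2 gives \<open>0 \<le> q 0\<close>, the factor 1/2 gives
    \<open>q 0 \<le> 0\<close>.\<close>
  have "q 0 = 0"
    using sublinear_scale[OF q, of 2 0] sublinear_scale[OF q, of "1/2" 0] by simp
  with True show ?thesis by simp
next
  case False
  with that have t: "t > 0" by simp
  then have "q x \<le> inverse t * q (t *\<^sub>R x)"
    using sublinear_scale[OF q, of "inverse t" "t *\<^sub>R x"] by simp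
  with t have "t * q x \<le> q (t *\<^sub>R x)"
    by (simp add: field_simps)
  with sublinear_scale[OF q t] show ?thesis
    by (intro antisym)
qed

lemma sublinear_minus: "- q (- x) \<le> q x" if "sublinear q"
  using sublinear_add[OF that, of x "- x"] sublinear_scale_eq[OF that, of 0 0] by simp

text \<open>The lowering of \<open>q\<close> that makes it linear along \<open>a\<close>: for
  sublinear \<open>q\<close> it stays below \<open>q\<close> and is at most \<open>- q a\<close> at
  \<open>- a\<close>, so every linear functional below it takes the value \<open>q a\<close> at
  \<open>a\<close>.\<close>

definition sublinear_shift :: "'a::real_vector \<Rightarrow> ('a \<Rightarrow> real) \<Rightarrow> 'a \<Rightarrow> real" where
  "sublinear_shift a q x = (INF t\<in>{0..}. q (x + t *\<^sub>R a) - t * q a)"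

context
  fixes q :: "'a::real_vector \<Rightarrow> real"
  assumes q: "sublinear q"
begin

lemma sublinear_shift_le:
  assumes "t \<ge> 0"
  shows "sublinear_shift a q x \<le> q (x + t *\<^sub>R a) - t * q a"
proof -
  \<comment> \<open>Subadditivity supplies a lower bound independent of \<open>t\<close>, so the
    infimum is a genuine one.\<close>
  have "- q (- x) \<le> q (x + t *\<^sub>R a) - t * q a" if "t \<ge> 0" for t
    using sublinear_add[OF q, of "x + t *\<^sub>R a" "- x"] sublinear_scale_eq[OF q that, of a] by simp
  then have "bdd_below ((\<lambda>t. q (x + t *\<^sub>R a) - t * q a) ` {0..})"
    by (intro bdd_belowI2[of _ "- q (- x)"]) auto
  then show ?thesis
    unfolding sublinear_shift_def using assms by (intro cINF_lower) auto
qed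

lemma sublinear_shift_greatest:
  assumes "\<And>t. t \<ge> 0 \<Longrightarrow> c \<le> q (x + t *\<^sub>R a) - t * q a"
  shows "c \<le> sublinear_shift a q x"
  unfolding sublinear_shift_def using assms by (intro cINF_greatest) auto

text \<open>For the sum, parameters \<open>t\<close> at \<open>x\<close> and \<open>s\<close> at
  \<open>y\<close> combine to \<open>t + s\<close>, and the two infima are taken one after the
  other. For the multiple by \<open>r\<close>, the parameter \<open>t\<close> is replaced by
  \<open>r * t\<close>.\<close>

lemma sublinear_shift: "sublinear (sublinear_shift a q)"
  unfolding sublinear_def
proof (intro conjI allI impI)
  show "sublinear_shift a q (x + y) \<le> sublinear_shift a q x + sublinear_shift a q y" for x y
  proof -
    have "sublinear_shift a q (x + y) - (q (y + s *\<^sub>R a) - s * q a) \<le> sublinear_shift a q x"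
      if "s \<ge> 0" for s
    proof (rule sublinear_shift_greatest)
      fix t :: real assume "t \<ge> 0"
      then show "sublinear_shift a q (x + y) - (q (y + s *\<^sub>R a) - s * q a) \<le> q (x + t *\<^sub>R a) - t * q a"
        using sublinear_shift_le[of "t + s" a "x + y"] that
          sublinear_add[OF q, of "x + t *\<^sub>R a" "y + s *\<^sub>R a"]
        by (simp add: algebra_simps)
    qed
    then have "sublinear_shift a q (x + y) - sublinear_shift a q x \<le> sublinear_shift a q y"
      by (intro sublinear_shift_greatest) (simp add: algebra_simps)
    then show ?thesis by simp
  qed
  show "sublinear_shift a q (r *\<^sub>R x) \<le> r * sublinear_shift a q x" if "r > 0" for r x
  proof -
    have "sublinear_shift a q (r *\<^sub>R x) / r \<le> sublinear_shift a q x"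
    proof (rule sublinear_shift_greatest)
      fix t :: real assume "t \<ge> 0"
      then show "sublinear_shift a q (r *\<^sub>R x) / r \<le> q (x + t *\<^sub>R a) - t * q a"
        using sublinear_shift_le[of "r * t" a "r *\<^sub>R x"] that
          sublinear_scale_eq[OF q, of r "x + t *\<^sub>R a"]
        by (simp add: field_simps scaleR_add_right)
    qed
    with that show ?thesis
      by (simp add: field_simps)
  qed
qed

end

text \<open>A pointwise minimal sublinear functional \<open>m\<close> is additive, since
  \<open>sublinear_shift a m = m\<close> gives \<open>m x + m a \<le> m (x + a)\<close>.\<close>

lemma linear_below_sublinear:
  assumes p: "sublinear p"
  shows "\<exists>f. linear f \<and> (\<forall>x. f x \<le> p x)"
proof -
  define A where "A = {q. sublinear q \<and> (\<forall>x. q x \<le> p x)}"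
  \<comment> \<open>The order is reversed, so that a maximal element in Zorn's lemma is a pointwise
    minimal functional.\<close>
  define P where "P = (\<lambda>q r :: 'a \<Rightarrow> real. \<forall>x. r x \<le> q x)"
  have "\<exists>m\<in>A. \<forall>q\<in>A. P m q \<longrightarrow> q = m"
  proof (rule predicate_Zorn)
    show "partial_order_on A (relation_of P A)"
    proof (rule partial_order_on_relation_ofI)
      show "P a c" if "P a b" "P b c" for a b c
        using that unfolding P_def by (meson order_trans)
      show "a = b" if "P a b" "P b a" for a b
        using that unfolding P_def by (intro ext antisym) auto
    qed (simp add: P_def)
    fix C assume C: "C \<in> Chains (relation_of P A)"
    show "\<exists>u\<in>A. \<forall>q\<in>C. P q u"
    proof (cases "C = {}")
      case True
      with p show ?thesis by (auto simp: A_def)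
    next
      case False
      have CA: "C \<subseteq> A" and chain: "q \<in> C \<Longrightarrow> r \<in> C \<Longrightarrow> P q r \<or> P r q" for q r
        using C unfolding Chains_def relation_of_def by blast+
      have sub: "sublinear q" and below: "q x \<le> p x" if "q \<in> C" for q x
        using CA that by (auto simp: A_def)
      \<comment> \<open>The pointwise infimum bounds the chain in the reversed order; it is finite
        because every member is at least \<open>- p (- x)\<close> at \<open>x\<close>.\<close>
      define u where "u x = (INF q\<in>C. q x)" for x
      have u_le: "u x \<le> q x" if "q \<in> C" for x q
      proof -
        have "- p (- x) \<le> q x" if "q \<in> C" for q
          using sublinear_minus[OF sub[OF that], of x] below[OF that, of "- x"] by simp
        then show ?thesis
          unfolding u_def using that by (intro cINF_lower bdd_belowI2[of _ "- p (- x)"]) auto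
      qed
      have u_ge: "c \<le> u x" if "\<And>q. q \<in> C \<Longrightarrow> c \<le> q x" for c x
        unfolding u_def using False that by (intro cINF_greatest) auto
      have "u (x + y) \<le> u x + u y" for x y
      proof -
        \<comment> \<open>Of two members of a chain the smaller one can be used for both
          arguments.\<close>
        have *: "u (x + y) \<le> q x + r y" if qr: "q \<in> C" "r \<in> C" for q r
          using chain[OF qr]
        proof
          assume "P q r"
          then have "r x \<le> q x"
            by (simp add: P_def)
          then show ?thesis
            using u_le[OF qr(2), of "x + y"] sublinear_add[OF sub[OF qr(2)], of x y] by simp
        next
          assume "P r q"
          then have "q y \<le> r y"
            by (simp add: P_def)
          then show ?thesis
            using u_le[OF qr(1), of "x + y"] sublinear_add[OF sub[OF qr(1)], of x y] by simp
        qed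
        have "u (x + y) - r y \<le> u x" if "r \<in> C" for r
          by (rule u_ge) (use *[OF _ that] in \<open>simp add: algebra_simps\<close>)
        then have "u (x + y) - u x \<le> u y"
          by (intro u_ge) (simp add: algebra_simps)
        then show ?thesis by simp
      qed
      moreover have "u (t *\<^sub>R x) \<le> t * u x" if t: "t > 0" for t x
      proof -
        have "u (t *\<^sub>R x) / t \<le> u x"
        proof (rule u_ge)
          fix q assume q: "q \<in> C"
          show "u (t *\<^sub>R x) / t \<le> q x"
            using u_le[OF q, of "t *\<^sub>R x"] sublinear_scale[OF sub[OF q] t, of x] t
            by (simp add: field_simps)
        qed
        with t show ?thesis by (simp add: field_simps)
      qed
      ultimately have "sublinear u"
        by (simp add: sublinear_def)
      moreover have "u x \<le> p x" for x
      proof -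
        from False obtain q where "q \<in> C" by auto
        from u_le[OF this, of x] below[OF this, of x] show ?thesis by simp
      qed
      ultimately show ?thesis
        using u_le by (auto simp: A_def P_def)
    qed
  qed
  then obtain m where m: "sublinear m" "\<And>x. m x \<le> p x"
    and min: "\<And>q. q \<in> A \<Longrightarrow> P m q \<Longrightarrow> q = m"
    by (auto simp: A_def)
  have add: "m (x + a) = m x + m a" for x a
  proof (rule antisym)
    have le: "sublinear_shift a m x \<le> m x" for x
      using sublinear_shift_le[OF m(1), of 0 a x] by simp
    have "sublinear_shift a m = m"
      using le order_trans[OF le m(2)] sublinear_shift[OF m(1)] by (intro min) (auto simp: A_def P_def)
    then show "m x + m a \<le> m (x + a)"
      using sublinear_shift_le[OF m(1), of 1 a x] by simp
  qed (rule sublinear_add[OF m(1)])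
  have m0: "m 0 = 0"
    using add[of 0 0] by simp
  have minus: "m (- x) = - m x" for x
    using add[of x "- x"] m0 by simp
  have "m (t *\<^sub>R x) = t * m x" for t x
  proof (cases "t \<ge> 0")
    case False
    then show ?thesis
      using sublinear_scale_eq[OF m(1), of "- t" x] minus[of "t *\<^sub>R x"] by simp
  qed (rule sublinear_scale_eq[OF m(1)])
  with add have "linear m"
    by (intro linearI) auto
  with m(2) show ?thesis by blast
qed

text \<open>A linear functional below \<open>sublinear_shift z p\<close> is below \<open>p\<close>,
  and the parameter 1 at \<open>- z\<close> forces its value at \<open>z\<close> up to
  \<open>p z\<close>.\<close>

theorem hahn_banach_sublinear:
  assumes p: "sublinear p"
  obtains f where "linear f" "\<And>x. f x \<le> p x" "f z = p z"
proof -
  obtain f where f: "linear f" "\<And>x. f x \<le> sublinear_shift z p x"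
    using linear_below_sublinear[OF sublinear_shift[OF p, of z]] by blast
  have *: "f x \<le> p x" for x
    using f(2)[of x] sublinear_shift_le[OF p, of 0 z x] by simp
  have "f (- z) \<le> - p z"
    using f(2)[of "- z"] sublinear_shift_le[OF p, of 1 z "- z"] sublinear_scale_eq[OF p, of 0 0]
    by simp
  then have "f z = p z"
    using *[of z] linear_neg[OF f(1), of z] by simp
  with f(1) * show ?thesis by (rule that)
qed

text \<open>Hahn-Banach is applied with the norm of the positive part instead of the norm. This
  majorant vanishes at \<open>- x\<close> for positive \<open>x\<close>, which makes the functional
  positive; it lies below the norm and agrees with it at \<open>z\<close>.\<close>

lemma positive_norming_functional:
  fixes z :: "'a::banach_lattice"
  assumes "0 \<le> z"
  obtains f :: "'a \<Rightarrow>\<^sub>L real" where "0 \<le> f" "norm f \<le> 1" "blinfun_apply f z = norm z"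
proof -
  define p where "p x = norm (pprt x)" for x :: 'a
  have "sublinear p"
    unfolding sublinear_def
  proof (intro conjI allI impI)
    show "p (x + y) \<le> p x + p y" for x y
      unfolding p_def by (rule order_trans[OF norm_mono[OF _ pprt_add_le] norm_triangle_ineq]) simp
    show "p (t *\<^sub>R x) \<le> t * p x" if "t > 0" for t x
    proof -
      have "pprt (t *\<^sub>R x) \<le> t *\<^sub>R pprt x"
        using that by (simp add: pprt_def scaleR_left_mono scaleR_nonneg_nonneg)
      then show ?thesis
        using norm_mono[of "pprt (t *\<^sub>R x)" "t *\<^sub>R pprt x"] that by (simp add: p_def)
    qed
  qed
  then obtain f where f: "linear f" "\<And>x. f x \<le> p x" "f z = p z"
    using hahn_banach_sublinear by blast
  have le: "f x \<le> norm x" for x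
    using f(2)[of x] norm_pprt_le[of x] by (simp add: p_def)
  have abs: "\<bar>f x\<bar> \<le> norm x * 1" for x
    using le[of x] le[of "- x"] linear_neg[OF f(1), of x] by simp
  with f(1) have bl: "bounded_linear f"
    by (intro bounded_linear_intro[where K=1]) (auto simp: linear_add linear_scale)
  have "f x \<ge> 0" if "0 \<le> x" for x
    using f(2)[of "- x"] linear_neg[OF f(1), of x] that by (simp add: p_def)
  then have "0 \<le> Blinfun f"
    by (simp add: zero_le_blinfun_iff bounded_linear_Blinfun_apply[OF bl])
  moreover have "norm (Blinfun f) \<le> 1"
    using abs by (intro norm_blinfun_bound) (auto simp: bounded_linear_Blinfun_apply[OF bl])
  moreover have "blinfun_apply (Blinfun f) z = norm z"
    using f(3) assms by (simp add: bounded_linear_Blinfun_apply[OF bl] p_def)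
  ultimately show ?thesis by (rule that)
qed

subsection \<open>Band components of positive functionals\<close>

lemma blinfun_mono: "blinfun_apply f x \<le> blinfun_apply f y" if "0 \<le> f" "x \<le> y"
  for f :: "'a::banach_lattice \<Rightarrow>\<^sub>L 'b::banach_lattice"
proof -
  have "0 \<le> blinfun_apply f (y - x)"
    using that by (simp add: zero_le_blinfun_iff)
  then show ?thesis
    by (simp add: blinfun.diff_right)
qed

lemma blinfun_nonneg: "0 \<le> blinfun_apply f x" if "0 \<le> f" "0 \<le> x"
  for f :: "'a::banach_lattice \<Rightarrow>\<^sub>L 'b::banach_lattice"
  using that by (simp add: zero_le_blinfun_iff)

text \<open>Kantorovich extension: the functional is the difference of the values of
  \<open>\<phi>\<close> at the positive and the negative part. Both values lie between 0 and
  \<open>norm x * K\<close>, so the constant \<open>K\<close> is kept.\<close>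

lemma positive_functional_extension:
  fixes \<phi> :: "'a::banach_lattice \<Rightarrow> real"
  assumes add: "\<And>x y. 0 \<le> x \<Longrightarrow> 0 \<le> y \<Longrightarrow> \<phi> (x + y) = \<phi> x + \<phi> y"
    and scale: "\<And>t x. 0 < t \<Longrightarrow> 0 \<le> x \<Longrightarrow> \<phi> (t *\<^sub>R x) = t * \<phi> x"
    and nonneg: "\<And>x. 0 \<le> x \<Longrightarrow> 0 \<le> \<phi> x" and bound: "\<And>x. 0 \<le> x \<Longrightarrow> \<phi> x \<le> norm x * K"
    and K: "0 \<le> K"
  obtains g :: "'a \<Rightarrow>\<^sub>L real" where "\<And>x. 0 \<le> x \<Longrightarrow> blinfun_apply g x = \<phi> x"
proof -
  define F where "F x = \<phi> (pprt x) - \<phi> (pprt (- x))" for x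
  have diff: "pprt x - pprt (- x) = x" for x :: 'a
    using prts[of x] by (simp add: pprt_neg)
  have \<phi>0: "\<phi> 0 = 0"
    using add[of 0 0] by simp
  have F_add: "F (x + y) = F x + F y" for x y
  proof -
    \<comment> \<open>Two decompositions of one positive element, arranged without subtraction so
      that additivity of \<open>\<phi>\<close> on the cone applies.\<close>
    have "pprt (x + y) + (pprt (- x) + pprt (- y)) = pprt (- (x + y)) + (pprt x + pprt y)"
      using diff[of x] diff[of y] diff[of "x + y"] by (simp add: algebra_simps)
    then have "\<phi> (pprt (x + y) + (pprt (- x) + pprt (- y))) = \<phi> (pprt (- (x + y)) + (pprt x + pprt y))"
      by simp
    then show ?thesis
      by (simp add: F_def add add_nonneg_nonneg del: minus_add_distrib)
  qed
  have F_minus: "F (- x) = - F x" for x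
    by (simp add: F_def)
  have F_pos: "F (t *\<^sub>R x) = t * F x" if "t > 0" for t x
  proof -
    have "pprt (- (t *\<^sub>R x)) = t *\<^sub>R pprt (- x)"
      using pprt_scaleR[OF that, of "- x"] by simp
    then show ?thesis
      using that by (simp add: F_def pprt_scaleR scale right_diff_distrib)
  qed
  have F_scale: "F (t *\<^sub>R x) = t * F x" for t x
    using F_pos[of t x] F_pos[of "- t" x] F_minus[of "t *\<^sub>R x"]
    by (cases t "0::real" rule: linorder_cases) (auto simp: F_def)
  have "norm (F x) \<le> norm x * K" for x
  proof -
    have "0 \<le> \<phi> (pprt x)" "0 \<le> \<phi> (pprt (- x))"
      by (simp_all add: nonneg)
    moreover have "\<phi> (pprt x) \<le> norm x * K" "\<phi> (pprt (- x)) \<le> norm x * K"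
      using bound[of "pprt x"] mult_right_mono[OF norm_pprt_le K, of x]
        bound[of "pprt (- x)"] mult_right_mono[OF norm_pprt_le K, of "- x"] by simp_all
    ultimately show ?thesis
      by (simp add: F_def)
  qed
  then have "bounded_linear F"
    by (intro bounded_linear_intro[where K=K]) (simp_all add: F_add F_scale)
  then show ?thesis
    by (intro that[of "Blinfun F"]) (simp add: bounded_linear_Blinfun_apply F_def \<phi>0)
qed

text \<open>For positive \<open>y\<close>, the value at \<open>y\<close> of the component of \<open>f\<close> carried by the band
  generated by a convex cone \<open>A\<close> of positive elements.\<close>

definition band_component :: "('a::banach_lattice \<Rightarrow>\<^sub>L real) \<Rightarrow> 'a set \<Rightarrow> 'a \<Rightarrow> real" where
  "band_component f A y = (SUP u\<in>A. blinfun_apply f (inf y u))"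

locale positive_cone =
  fixes A :: "'a::banach_lattice set"
  assumes nonempty: "A \<noteq> {}" and nonneg: "\<And>u. u \<in> A \<Longrightarrow> 0 \<le> u"
    and add: "\<And>u v. u \<in> A \<Longrightarrow> v \<in> A \<Longrightarrow> u + v \<in> A"
    and scale: "\<And>t u. 0 < t \<Longrightarrow> u \<in> A \<Longrightarrow> t *\<^sub>R u \<in> A"
begin

context
  fixes f :: "'a \<Rightarrow>\<^sub>L real"
  assumes f: "0 \<le> f"
begin

lemma band_component_upper: "blinfun_apply f (inf y u) \<le> band_component f A y" if "u \<in> A"
  unfolding band_component_def
  by (rule cSUP_upper[OF that], rule bdd_aboveI2[of _ _ "blinfun_apply f y"])
    (simp add: blinfun_mono[OF f])

lemma band_component_least:
  "band_component f A y \<le> c" if "\<And>u. u \<in> A \<Longrightarrow> blinfun_apply f (inf y u) \<le> c"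
  unfolding band_component_def using that nonempty by (intro cSUP_least)

lemma band_component_le: "band_component f A y \<le> blinfun_apply f y"
  by (intro band_component_least blinfun_mono[OF f]) simp

lemma band_component_nonneg: "0 \<le> band_component f A y" if "0 \<le> y"
proof -
  obtain u where "u \<in> A"
    using nonempty by auto
  with band_component_upper[OF this, of y] blinfun_nonneg[OF f, of "inf y u"] that nonneg
  show ?thesis by fastforce
qed

text \<open>One inequality is \<open>inf_add_le\<close> for a single \<open>u\<close>. For the
  other, \<open>u\<close> and \<open>v\<close> are chosen independently for \<open>x\<close> and
  \<open>y\<close>, and \<open>u + v\<close> again belongs to the cone.\<close>

lemma band_component_add:
  assumes "0 \<le> x" "0 \<le> y"
  shows "band_component f A (x + y) = band_component f A x + band_component f A y"
proof (rule antisym)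
  show "band_component f A (x + y) \<le> band_component f A x + band_component f A y"
  proof (rule band_component_least)
    fix u assume u: "u \<in> A"
    have "blinfun_apply f (inf (x + y) u) \<le> blinfun_apply f (inf x u + inf y u)"
      using assms u nonneg by (intro blinfun_mono[OF f] inf_add_le) auto
    then show "blinfun_apply f (inf (x + y) u) \<le> band_component f A x + band_component f A y"
      using band_component_upper[OF u, of x] band_component_upper[OF u, of y]
      by (simp add: blinfun.add_right)
  qed
  have *: "blinfun_apply f (inf x u) + blinfun_apply f (inf y v) \<le> band_component f A (x + y)"
    if "u \<in> A" "v \<in> A" for u v
  proof -
    have "inf x u + inf y v \<le> inf (x + y) (u + v)"
      by (simp add: add_mono)
    then have "blinfun_apply f (inf x u + inf y v) \<le> blinfun_apply f (inf (x + y) (u + v))"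
      by (rule blinfun_mono[OF f])
    then show ?thesis
      using band_component_upper[OF add[OF that], of "x + y"] by (simp add: blinfun.add_right)
  qed
  have "band_component f A y \<le> band_component f A (x + y) - blinfun_apply f (inf x u)"
    if "u \<in> A" for u
    by (rule band_component_least) (use *[OF that] in \<open>simp add: algebra_simps\<close>)
  then have "band_component f A x \<le> band_component f A (x + y) - band_component f A y"
    by (intro band_component_least) (simp add: algebra_simps)
  then show "band_component f A x + band_component f A y \<le> band_component f A (x + y)"
    by simp
qed

lemma band_component_scale:
  assumes "0 < t"
  shows "band_component f A (t *\<^sub>R y) = t * band_component f A y"
proof -
  \<comment> \<open>Used for \<open>t\<close> at \<open>y\<close> and for \<open>inverse t\<close>
    at the multiple of \<open>y\<close>, this gives both inequalities.\<close>
  have le: "t * band_component f A y \<le> band_component f A (t *\<^sub>R y)" if t: "0 < t" for t y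
  proof -
    have "band_component f A y \<le> band_component f A (t *\<^sub>R y) / t"
    proof (rule band_component_least)
      fix u assume "u \<in> A"
      from band_component_upper[OF scale[OF t this], of "t *\<^sub>R y"] t
      show "blinfun_apply f (inf y u) \<le> band_component f A (t *\<^sub>R y) / t"
        by (simp add: inf_scaleR blinfun.scaleR_right field_simps)
    qed
    with t show ?thesis
      by (simp add: field_simps)
  qed
  show ?thesis
    using le[OF assms, of y] le[of "inverse t" "t *\<^sub>R y"] assms by (simp add: field_simps)
qed

lemma band_functional:
  obtains g where "\<And>y. 0 \<le> y \<Longrightarrow> blinfun_apply g y = band_component f A y"
proof (rule positive_functional_extension)
  show "band_component f A y \<le> norm y * norm f" for y
    using band_component_le[of y] norm_blinfun[of f y] by (simp add: mult.commute)
qed (auto intro: band_component_add band_component_scale band_component_nonneg that)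

end

end

lemma positive_coneI: "positive_cone A"
  if "0 \<in> A" "\<And>u. u \<in> A \<Longrightarrow> 0 \<le> u" "\<And>u v. u \<in> A \<Longrightarrow> v \<in> A \<Longrightarrow> u + v \<in> A"
    "\<And>t u. 0 < t \<Longrightarrow> u \<in> A \<Longrightarrow> t *\<^sub>R u \<in> A"
  using that by unfold_locales auto

text \<open>Let \<open>g N\<close> be the component of \<open>f\<close> for the first
  \<open>N\<close> terms and \<open>S\<close> the one for all terms. At \<open>x n\<close> with
  \<open>N \<le> n\<close>, \<open>S\<close> is at least \<open>f\<close> while \<open>g N\<close>
  is at most 0, so \<open>f\<close> is bounded there by \<open>norm (S - g N) * norm (x n)\<close>.
  Order continuity of the dual norm makes \<open>norm (S - g N)\<close> small.\<close>

lemma disjoint_null_functional: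
  fixes x :: "nat \<Rightarrow> 'a::banach_lattice" and f :: "'a \<Rightarrow>\<^sub>L real"
  assumes oc: "order_continuous_norm TYPE('a \<Rightarrow>\<^sub>L real)" and f: "0 \<le> f"
    and x: "\<And>n. 0 \<le> x n" "\<And>m n. m \<noteq> n \<Longrightarrow> inf (x m) (x n) = 0" "\<And>n. norm (x n) \<le> B"
  shows "(\<lambda>n. blinfun_apply f (x n)) \<longlonglongrightarrow> 0"
proof -
  define s where "s N = (\<Sum>i<N. x i)" for N
  \<comment> \<open>The positive part of the ideal generated by \<open>s N\<close>; these cones
    increase with \<open>N\<close>.\<close>
  define A where "A N = {y. 0 \<le> y \<and> (\<exists>t\<ge>0. y \<le> t *\<^sub>R s N)}" for N
  have s0: "0 \<le> s N" for N
    unfolding s_def by (intro sum_nonneg x(1))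
  have s_mono: "s M \<le> s N" if "M \<le> N" for M N
    unfolding s_def using that x(1) by (intro sum_mono2) auto
  have A_mono: "A M \<subseteq> A N" if "M \<le> N" for M N
  proof
    fix y assume "y \<in> A M"
    then obtain t where t: "t \<ge> 0" "0 \<le> y" "y \<le> t *\<^sub>R s M"
      by (auto simp: A_def)
    then have "y \<le> t *\<^sub>R s N"
      using scaleR_left_mono[OF s_mono[OF that] t(1)] by simp
    with t show "y \<in> A N" by (auto simp: A_def)
  qed
  have A_add: "u + v \<in> A N" if "u \<in> A N" "v \<in> A N" for u v N
  proof -
    from that obtain t r where "t \<ge> 0" "0 \<le> u" "u \<le> t *\<^sub>R s N" "r \<ge> 0" "0 \<le> v" "v \<le> r *\<^sub>R s N"
      by (auto simp: A_def)
    then have "0 \<le> u + v" "u + v \<le> (t + r) *\<^sub>R s N" "t + r \<ge> 0"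
      by (simp_all add: scaleR_add_left add_mono)
    then show ?thesis by (auto simp: A_def)
  qed
  have A_scale: "c *\<^sub>R u \<in> A N" if "u \<in> A N" "0 < c" for u c N
  proof -
    from that obtain t where t: "t \<ge> 0" "0 \<le> u" "u \<le> t *\<^sub>R s N"
      by (auto simp: A_def)
    then have "c *\<^sub>R u \<le> (c * t) *\<^sub>R s N" "0 \<le> c *\<^sub>R u" "0 \<le> c * t"
      using scaleR_left_mono[OF t(3), of c] that(2) by (simp_all add: scaleR_nonneg_nonneg)
    then show ?thesis by (auto simp: A_def)
  qed
  have cone: "positive_cone (A N)" for N
  proof (rule positive_coneI)
    show "0 \<in> A N" "\<And>u. u \<in> A N \<Longrightarrow> 0 \<le> u"
      by (auto simp: A_def)
  qed (rule A_add A_scale; assumption)+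
  have cone': "positive_cone (\<Union>N. A N)"
  proof (rule positive_coneI)
    show "u + v \<in> (\<Union>N. A N)" if uv: "u \<in> (\<Union>N. A N)" "v \<in> (\<Union>N. A N)" for u v
    proof -
      from uv obtain M N where "u \<in> A M" "v \<in> A N" by auto
      then have "u \<in> A (max M N)" "v \<in> A (max M N)"
        using A_mono[of M "max M N"] A_mono[of N "max M N"] by auto
      then show ?thesis using A_add by blast
    qed
    show "0 \<in> (\<Union>N. A N)" "\<And>u. u \<in> (\<Union>N. A N) \<Longrightarrow> 0 \<le> u"
      by (auto simp: A_def intro!: exI[of _ 0])
    show "t *\<^sub>R u \<in> (\<Union>N. A N)" if "0 < t" "u \<in> (\<Union>N. A N)" for t u
      using that A_scale by auto
  qed
  obtain S where S: "\<And>y. 0 \<le> y \<Longrightarrow> blinfun_apply S y = band_component f (\<Union>N. A N) y"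
    using positive_cone.band_functional[OF cone' f] by blast
  have "\<forall>N. \<exists>g. \<forall>y\<ge>0. blinfun_apply g y = band_component f (A N) y"
    using positive_cone.band_functional[OF cone f] by metis
  then obtain g where g: "\<And>N y. 0 \<le> y \<Longrightarrow> blinfun_apply (g N) y = band_component f (A N) y"
    by metis
  note upper = positive_cone.band_component_upper[OF cone f]
    and upper' = positive_cone.band_component_upper[OF cone' f]
    and least = positive_cone.band_component_least[OF cone f]
    and least' = positive_cone.band_component_least[OF cone' f]
  have g_mono: "g M \<le> g N" if "M \<le> N" for M N
    unfolding less_eq_blinfun_def
    using A_mono[OF that] upper by (auto simp: g intro!: least)
  have g_le: "g N \<le> S" for N
    unfolding less_eq_blinfun_def using upper' by (auto simp: g S intro!: least)
  have small: "\<exists>h\<in>range (\<lambda>N. S - g N). norm h < e" if "e > 0" for e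
  proof (rule order_continuous_norm_small[OF oc _ _ _ _ that])
    show "\<exists>z\<in>range (\<lambda>N. S - g N). z \<le> h \<and> z \<le> h'"
      if "h \<in> range (\<lambda>N. S - g N)" "h' \<in> range (\<lambda>N. S - g N)" for h h'
    proof -
      from that obtain M N where "h = S - g M" "h' = S - g N" by auto
      then show ?thesis
        by (intro bexI[of _ "S - g (max M N)"] conjI) (auto intro!: diff_left_mono g_mono)
    qed
    show "l \<le> 0" if l: "\<And>h. h \<in> range (\<lambda>N. S - g N) \<Longrightarrow> l \<le> h" for l
      unfolding less_eq_blinfun_def
    proof (intro allI impI)
      fix y :: 'a assume y: "0 \<le> y"
      \<comment> \<open>Each \<open>u\<close> of the union lies in a single \<open>A N\<close>, and
        \<open>l\<close> is below \<open>S - g N\<close>; so the value of \<open>S\<close> at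
        \<open>y\<close>, lowered by that of \<open>l\<close>, still bounds every term of the
        supremum defining it.\<close>
      have "blinfun_apply S y \<le> blinfun_apply S y - blinfun_apply l y"
        unfolding S[OF y]
      proof (rule least')
        fix u assume "u \<in> (\<Union>N. A N)"
        then obtain N where u: "u \<in> A N" by auto
        have "blinfun_apply l y \<le> blinfun_apply (S - g N) y"
          using l[of "S - g N"] y by (auto simp: less_eq_blinfun_def)
        then show "blinfun_apply f (inf y u) \<le> band_component f (\<Union>N. A N) y - blinfun_apply l y"
          using upper[OF u, of y] by (simp add: blinfun.diff_left S[OF y] g[OF y])
      qed
      then show "blinfun_apply l y \<le> blinfun_apply 0 y" by simp
    qed
  qed (use g_le in auto)
  have B: "B \<ge> 0"
    using order_trans[OF norm_ge_zero x(3)] .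
  show ?thesis
  proof (rule LIMSEQ_I)
    fix e :: real assume "e > 0"
    \<comment> \<open>The summand 1 covers the case \<open>B = 0\<close>.\<close>
    then have "e / (B + 1) > 0"
      using B by simp
    from small[OF this] obtain N where N: "norm (S - g N) < e / (B + 1)"
      by auto
    have "norm (blinfun_apply f (x n) - 0) < e" if n: "n \<ge> N" for n
    proof -
      have "x n \<le> s (Suc n)"
        using s0[of n] by (simp add: s_def)
      then have "x n \<in> A (Suc n)"
        unfolding A_def using x(1) by (auto intro!: exI[of _ 1])
      then have 1: "blinfun_apply f (x n) \<le> blinfun_apply S (x n)"
        using upper'[of "x n" "x n"] x(1) by (auto simp: S)
      have "blinfun_apply (g N) (x n) \<le> 0"
        unfolding g[OF x(1)]
      proof (rule least)
        fix u assume "u \<in> A N"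
        then obtain t where t: "t \<ge> 0" "0 \<le> u" "u \<le> t *\<^sub>R s N" by (auto simp: A_def)
        \<comment> \<open>The sum \<open>s N\<close> involves only indices below \<open>N\<close>,
          so it is disjoint from \<open>x n\<close> already for \<open>n = N\<close>.\<close>
        have "inf (x n) (s N) = 0"
          unfolding s_def by (subst inf_commute, intro inf_sum_eq_0) (use n x in auto)
        then have "inf (1 *\<^sub>R x n) (t *\<^sub>R s N) = 0"
          using t x(1) s0 by (intro inf_scaleR_eq_0) auto
        then have "inf (x n) u \<le> 0"
          using inf_mono[OF order_refl t(3), of "x n"] by simp
        then show "blinfun_apply f (inf (x n) u) \<le> 0"
          using blinfun_mono[OF f, of "inf (x n) u" 0] by simp
      qed
      with 1 have "blinfun_apply f (x n) \<le> blinfun_apply (S - g N) (x n)"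
        by (simp add: blinfun.diff_left)
      also have "\<dots> \<le> norm (S - g N) * norm (x n)"
        using norm_blinfun[of "S - g N" "x n"] by simp
      also have "\<dots> \<le> norm (S - g N) * (B + 1)"
        using x(3)[of n] by (intro mult_left_mono) auto
      also have "\<dots> < e"
        using N B by (simp add: field_simps)
      finally show ?thesis
        using blinfun_nonneg[OF f x(1), of n] by simp
    qed
    then show "\<exists>N. \<forall>n\<ge>N. norm (blinfun_apply f (x n) - 0) < e" by blast
  qed
qed

subsection \<open>Order bounded and almost disjoint subsequences\<close>

text \<open>Indices are chosen recursively, the requirement on each depending on the sum of the
  terms chosen before. The recursion therefore runs on pairs of an index and the running sum, which
  starts at 0.\<close>

lemma frequently_subsequence_sum:
  fixes y :: "nat \<Rightarrow> 'a::ordered_ab_group_add"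
  assumes y: "\<And>n. 0 \<le> y n" and Q: "\<And>k w. 0 \<le> w \<Longrightarrow> \<exists>\<^sub>F n in sequentially. Q k w n"
  obtains r :: "nat \<Rightarrow> nat" where "strict_mono r" "\<And>k. Q k (\<Sum>i<k. y (r i)) (r k)"
proof -
  have ex: "\<exists>n>m. Q k w n" if "0 \<le> w" for k w m
    using Q[OF that, of k] unfolding frequently_sequentially by (meson Suc_le_lessD)
  have "\<exists>\<sigma>. \<forall>k. (0 \<le> snd (\<sigma> k) \<and> Q k (snd (\<sigma> k)) (fst (\<sigma> k)) \<and> (k = 0 \<longrightarrow> snd (\<sigma> k) = 0)) \<and>
    (fst (\<sigma> k) < fst (\<sigma> (Suc k)) \<and> snd (\<sigma> (Suc k)) = snd (\<sigma> k) + y (fst (\<sigma> k)))"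
  proof (rule dependent_nat_choice)
    show "\<exists>s. 0 \<le> snd s \<and> Q 0 (snd s) (fst s) \<and> (0 = (0::nat) \<longrightarrow> snd s = 0)"
      using ex[of 0 0 0] by auto
    fix s k assume "0 \<le> snd s \<and> Q k (snd s) (fst s) \<and> (k = 0 \<longrightarrow> snd s = 0)"
    then have "0 \<le> snd s + y (fst s)"
      using y by (simp add: add_nonneg_nonneg)
    then show "\<exists>s'. (0 \<le> snd s' \<and> Q (Suc k) (snd s') (fst s') \<and> (Suc k = 0 \<longrightarrow> snd s' = 0)) \<and>
        fst s < fst s' \<and> snd s' = snd s + y (fst s)"
      using ex[of "snd s + y (fst s)" "fst s" "Suc k"] by auto
  qed
  then obtain \<sigma> where \<sigma>: "\<And>k. Q k (snd (\<sigma> k)) (fst (\<sigma> k))" "snd (\<sigma> 0) = 0"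
    "\<And>k. fst (\<sigma> k) < fst (\<sigma> (Suc k))" "\<And>k. snd (\<sigma> (Suc k)) = snd (\<sigma> k) + y (fst (\<sigma> k))"
    by blast
  have "snd (\<sigma> k) = (\<Sum>i<k. y (fst (\<sigma> i)))" for k
    by (induction k) (simp_all add: \<sigma>)
  with \<sigma>(1,3) show ?thesis
    by (intro that[of "\<lambda>k. fst (\<sigma> k)"]) (simp_all add: strict_mono_Suc_iff)
qed

lemma not_null_frequently:
  fixes X :: "nat \<Rightarrow> 'a::real_normed_vector"
  assumes "\<not> X \<longlonglongrightarrow> 0"
  obtains e where "0 < e" "\<exists>\<^sub>F n in sequentially. e \<le> norm (X n)"
  using assms by (auto simp: tendsto_iff not_eventually not_less)

lemma lattice_LIMSEQ_ge: "a \<le> l" if "X \<longlonglongrightarrow> l" "\<And>n. n \<ge> N \<Longrightarrow> a \<le> X n"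
  for X :: "nat \<Rightarrow> 'a::banach_lattice"
  using LIMSEQ_lattice_mono[OF tendsto_const LIMSEQ_ignore_initial_segment[OF that(1), of N], of a] that(2)
  by simp

lemma lattice_suminf_upper:
  fixes f :: "nat \<Rightarrow> 'a::banach_lattice"
  assumes "summable f" "\<And>i. 0 \<le> f i"
  shows "f i \<le> suminf f"
proof (rule lattice_LIMSEQ_ge[OF summable_LIMSEQ[OF assms(1)]])
  show "f i \<le> (\<Sum>j<n. f j)" if "n \<ge> Suc i" for n
    using that assms(2) sum_mono2[of "{..<n}" "{i}" f] by auto
qed

text \<open>A single functional \<open>\<phi>\<close> dominates positive multiples of norming
  functionals for all \<open>y n\<close>. Along a subsequence with summable values of
  \<open>\<phi>\<close>, the truncated tail sums decrease in norm to some \<open>l\<close> with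
  \<open>\<phi>\<close> zero at \<open>l\<close>. The norming functionals then vanish at
  \<open>l\<close> too, which contradicts norms bounded away from 0.\<close>

lemma order_bounded_null:
  fixes y :: "nat \<Rightarrow> 'a::banach_lattice"
  assumes oc: "order_continuous_norm TYPE('a)"
    and y: "\<And>n. 0 \<le> y n" "\<And>n. y n \<le> u"
    and null: "\<And>\<phi> :: 'a \<Rightarrow>\<^sub>L real. 0 \<le> \<phi> \<Longrightarrow> (\<lambda>n. blinfun_apply \<phi> (y n)) \<longlonglongrightarrow> 0"
  shows "y \<longlonglongrightarrow> 0"
proof (rule ccontr)
  assume "\<not> y \<longlonglongrightarrow> 0"
  then obtain e where e: "0 < e" "\<exists>\<^sub>F n in sequentially. e \<le> norm (y n)"
    by (rule not_null_frequently)
  have "\<forall>n. \<exists>f :: 'a \<Rightarrow>\<^sub>L real. 0 \<le> f \<and> norm f \<le> 1 \<and> blinfun_apply f (y n) = norm (y n)"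
    using positive_norming_functional[OF y(1)] by metis
  then obtain f :: "nat \<Rightarrow> 'a \<Rightarrow>\<^sub>L real"
    where f: "\<And>n. 0 \<le> f n" "\<And>n. norm (f n) \<le> 1" "\<And>n. blinfun_apply (f n) (y n) = norm (y n)"
    by metis
  define \<phi> where "\<phi> = (\<Sum>n. (1/2) ^ n *\<^sub>R f n)"
  have sum_f: "summable (\<lambda>n. (1/2) ^ n *\<^sub>R f n)"
  proof (rule summable_comparison_test')
    show "summable (\<lambda>n. (1/2::real) ^ n)"
      by (intro summable_geometric) simp
    show "norm ((1/2) ^ n *\<^sub>R f n) \<le> (1/2) ^ n" if "n \<ge> 0" for n
      using f(2)[of n] by (simp add: mult_left_le)
  qed
  have \<phi>_apply: "(\<lambda>n. (1/2) ^ n * blinfun_apply (f n) x) sums blinfun_apply \<phi> x" for x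
    unfolding \<phi>_def
    using bounded_linear.sums[OF blinfun.bounded_linear_left summable_sums[OF sum_f], of x]
    by (simp add: blinfun.scaleR_left)
  have f_le_\<phi>: "(1/2) ^ n * blinfun_apply (f n) x \<le> blinfun_apply \<phi> x" if "0 \<le> x" for n x
    using sum_le_suminf[OF sums_summable[OF \<phi>_apply[of x]], of "{n}"] sums_unique[OF \<phi>_apply[of x]]
      blinfun_nonneg[OF f(1) that] by simp
  have \<phi>: "0 \<le> \<phi>"
    unfolding zero_le_blinfun_iff
  proof (intro allI impI)
    fix x :: 'a assume x: "0 \<le> x"
    have "0 \<le> (1/2) ^ 0 * blinfun_apply (f 0) x"
      using blinfun_nonneg[OF f(1) x, of 0] by simp
    with f_le_\<phi>[OF x, of 0] show "0 \<le> blinfun_apply \<phi> x"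
      by simp
  qed
  have "\<exists>\<^sub>F n in sequentially. e \<le> norm (y n) \<and> blinfun_apply \<phi> (y n) < (1/2) ^ k" for k
    using e(2) order_tendstoD(2)[OF null[OF \<phi>], of "(1/2) ^ k"] by (intro frequently_eventually_frequently) simp_all
  then obtain r where r: "strict_mono r"
      "\<And>k. e \<le> norm (y (r k)) \<and> blinfun_apply \<phi> (y (r k)) < (1/2) ^ k"
    \<comment> \<open>The zero sequence makes the running sum irrelevant; only the choice of indices
      is used.\<close>
    using frequently_subsequence_sum[of "\<lambda>_. 0::real"
        "\<lambda>k _ n. e \<le> norm (y n) \<and> blinfun_apply \<phi> (y n) < (1/2) ^ k"] by auto
  define v where "v k = y (r k)" for k
  \<comment> \<open>Cutting the finite tail sums at \<open>u\<close> keeps them order bounded, so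
    they converge as \<open>m\<close> grows. The limit \<open>S k\<close> still dominates
    \<open>v k\<close>.\<close>
  define s where "s k m = inf u (\<Sum>i\<in>{k..<m}. v i)" for k m
  have v: "0 \<le> v k" "v k \<le> u" for k
    by (simp_all add: v_def y)
  have u: "0 \<le> u"
    using order_trans[OF v] .
  have s0: "0 \<le> s k m" for k m
    using u v by (simp add: s_def sum_nonneg)
  have s_mono: "s k m \<le> s k' m'" if "k' \<le> k" "m \<le> m'" for k k' m m'
    unfolding s_def using that v by (intro inf_mono sum_mono2) auto
  have "convergent (s k)" for k
  proof (rule order_continuous_norm_Cauchy[OF oc])
    show "incseq (s k)"
      using s_mono by (auto simp: incseq_def)
    show "s k m \<le> u" for m
      by (simp add: s_def)
  qed
  then obtain S where S: "\<And>k. s k \<longlonglongrightarrow> S k"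
    unfolding convergent_def by metis
  have v_le_S: "v k \<le> S k" for k
  proof (rule lattice_LIMSEQ_ge[OF S])
    show "v k \<le> s k m" if "m \<ge> Suc k" for m
      using that v sum_mono2[of "{k..<m}" "{k}" v] by (auto simp: s_def)
  qed
  have S_Suc: "S (Suc k) \<le> S k" for k
    by (rule LIMSEQ_lattice_mono[OF S S]) (simp add: s_mono)
  have S0: "0 \<le> S k" for k
    using v(1) v_le_S order_trans by blast
  have \<phi>_S: "blinfun_apply \<phi> (S k) \<le> 2 * (1/2) ^ k" for k
  proof (rule LIMSEQ_le_const2[OF blinfun.tendsto[OF tendsto_const S]], intro exI allI impI)
    fix m
    have "blinfun_apply \<phi> (s k m) \<le> blinfun_apply \<phi> (\<Sum>i\<in>{k..<m}. v i)"
      by (rule blinfun_mono[OF \<phi>]) (simp add: s_def)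
    also have "\<dots> = (\<Sum>i\<in>{k..<m}. blinfun_apply \<phi> (v i))"
      by (simp add: blinfun.sum_right)
    also have "\<dots> \<le> (\<Sum>i\<in>{k..<m}. (1/2) ^ i)"
      using r(2) by (intro sum_mono) (auto simp: v_def intro: less_imp_le)
    also have "\<dots> \<le> 2 * (1/2) ^ k"
    proof (cases "k \<le> m")
      case True
      have "(\<Sum>i\<in>{k..<m}. (1/2::real) ^ i) = 2 * (1/2) ^ k - 2 * (1/2) ^ m"
        using True by (induction m rule: dec_induct) simp_all
      then show ?thesis by simp
    qed simp
    finally show "blinfun_apply \<phi> (s k m) \<le> 2 * (1/2) ^ k" .
  qed
  have "convergent (\<lambda>k. - S k)"
    by (rule order_continuous_norm_Cauchy[OF oc, of _ 0]) (auto intro: incseq_SucI simp: S_Suc S0)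
  then obtain l where "(\<lambda>k. - S k) \<longlonglongrightarrow> - l"
    unfolding convergent_def by (metis minus_minus)
  then have l: "S \<longlonglongrightarrow> l"
    by (simp add: tendsto_minus_cancel_left)
  have l0: "0 \<le> l"
    by (rule lattice_LIMSEQ_ge[OF l]) (rule S0)
  have "blinfun_apply \<phi> l \<le> 0"
  proof (rule LIMSEQ_le[OF blinfun.tendsto[OF tendsto_const l]])
    show "(\<lambda>k. 2 * (1/2) ^ k :: real) \<longlonglongrightarrow> 0"
      by (intro tendsto_mult_right_zero LIMSEQ_power_zero) simp
  qed (use \<phi>_S in auto)
  then have f_l: "blinfun_apply (f n) l = 0" for n
  proof -
    have "(1/2) ^ n * blinfun_apply (f n) l \<le> (1/2) ^ n * 0"
      using f_le_\<phi>[OF l0, of n] \<open>blinfun_apply \<phi> l \<le> 0\<close> by simp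
    then have "blinfun_apply (f n) l \<le> 0"
      by (rule mult_left_le_imp_le) simp
    then show ?thesis
      using blinfun_nonneg[OF f(1) l0, of n] by simp
  qed
  \<comment> \<open>The norming functional of \<open>v k\<close> does not see \<open>l\<close>, so
    it bounds the distance from \<open>S k\<close> to \<open>l\<close> below by
    \<open>norm (v k)\<close>.\<close>
  have "e \<le> norm (S k - l)" for k
  proof -
    have "e \<le> blinfun_apply (f (r k)) (v k)"
      using r(2)[of k] by (simp add: v_def f(3))
    also have "\<dots> \<le> blinfun_apply (f (r k)) (S k)"
      by (rule blinfun_mono[OF f(1) v_le_S])
    also have "\<dots> = blinfun_apply (f (r k)) (S k - l)"
      by (simp add: blinfun.diff_right f_l)
    also have "\<dots> \<le> norm (f (r k)) * norm (S k - l)"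
      using norm_blinfun[of "f (r k)" "S k - l"] by simp
    also have "\<dots> \<le> norm (S k - l)"
      using f(2)[of "r k"] by (simp add: mult_left_le_one_le)
    finally show ?thesis .
  qed
  moreover have "(\<lambda>k. norm (S k - l)) \<longlonglongrightarrow> 0"
    using l by (simp add: LIM_zero_iff tendsto_norm_zero_iff)
  ultimately have "e \<le> 0"
    by (intro LIMSEQ_le_const) auto
  with e(1) show False by simp
qed

text \<open>Disjointification: from the \<open>k\<close>-th chosen term subtract
  \<open>4 ^ k\<close> times the sum of the earlier chosen ones, then \<open>(1/2) ^ k\<close> times
  a series \<open>p\<close> of all chosen ones, and take the positive part. The first subtraction
  separates a term from earlier ones, the second from later ones. The predicate \<open>Q\<close> is
  imposed at the level \<open>w\<close> of the first subtraction.\<close>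

lemma almost_disjoint_subsequence:
  fixes y :: "nat \<Rightarrow> 'a::banach_lattice"
  assumes y: "\<And>n. 0 \<le> y n" "\<And>n. norm (y n) \<le> B"
    and Q: "\<And>k w. 0 \<le> w \<Longrightarrow> \<exists>\<^sub>F n in sequentially. Q k w n"
  obtains r :: "nat \<Rightarrow> nat" and z p where "strict_mono r"
    "\<And>i j. i \<noteq> j \<Longrightarrow> inf (z i) (z j) = 0" "\<And>k. 0 \<le> z k" "\<And>k. z k \<le> y (r k)"
    "\<And>k. \<exists>w\<ge>0. Q k w (r k) \<and> pprt (y (r k) - w) \<le> z k + (1/2) ^ k *\<^sub>R p"
proof -
  have "\<exists>\<^sub>F n in sequentially. Q k (4 ^ k *\<^sub>R w) n" if "0 \<le> w" for k w
    using that by (intro Q) (simp add: scaleR_nonneg_nonneg)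
  from frequently_subsequence_sum[of y "\<lambda>k w. Q k (4 ^ k *\<^sub>R w)", OF y(1) this]
  obtain r where r: "strict_mono r" "\<And>k. Q k (4 ^ k *\<^sub>R (\<Sum>i<k. y (r i))) (r k)"
    by blast
  define Y where "Y k = y (r k)" for k
  define w where "w k = 4 ^ k *\<^sub>R (\<Sum>i<k. Y i)" for k
  define p where "p = (\<Sum>i. (1/2) ^ i *\<^sub>R Y i)"
  define z where "z k = pprt (Y k - w k - (1/2) ^ k *\<^sub>R p)" for k
  have Y: "0 \<le> Y k" for k
    by (simp add: Y_def y)
  have w: "0 \<le> w k" for k
    unfolding w_def by (intro scaleR_nonneg_nonneg sum_nonneg Y) simp
  have "summable (\<lambda>i. (1/2) ^ i *\<^sub>R Y i)"
  proof (rule summable_comparison_test')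
    show "summable (\<lambda>i. (1/2::real) ^ i * B)"
      by (intro summable_mult2 summable_geometric) simp
    show "norm ((1/2) ^ i *\<^sub>R Y i) \<le> (1/2) ^ i * B" if "i \<ge> 0" for i
      using y(2) by (simp add: Y_def divide_right_mono)
  qed
  then have p: "(1/2) ^ i *\<^sub>R Y i \<le> p" for i
    unfolding p_def by (rule lattice_suminf_upper) (simp add: scaleR_nonneg_nonneg Y)
  have p0: "0 \<le> p"
    using p[of 0] Y[of 0] by simp
  have disj: "inf (z j) (z k) = 0" if "j < k" for j k
  proof -
    \<comment> \<open>For \<open>j < k\<close>, \<open>z k\<close> lies below the positive part of
      \<open>?a\<close> and \<open>z j\<close> below a multiple of its negative part, and these are
      disjoint.\<close>
    let ?a = "Y k - 4 ^ k *\<^sub>R Y j"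
    have "Y j \<le> (\<Sum>i<k. Y i)"
      using that Y sum_mono2[of "{..<k}" "{j}" Y] by auto
    then have "4 ^ k *\<^sub>R Y j \<le> w k"
      by (simp add: w_def scaleR_left_mono)
    moreover have "0 \<le> (1/2) ^ k *\<^sub>R p"
      using p0 by (simp add: scaleR_nonneg_nonneg)
    ultimately have "Y k - w k - (1/2) ^ k *\<^sub>R p \<le> ?a - 0"
      by (intro diff_mono) simp_all
    then have zk: "z k \<le> pprt ?a"
      by (simp add: z_def)
    \<comment> \<open>As \<open>(1/4) ^ k\<close> is at most \<open>(1/2) ^ j * (1/2) ^ k\<close>,
      the correction subtracted in \<open>z j\<close> already dominates \<open>(1/4) ^ k\<close>
      times \<open>Y k\<close>.\<close>
    have "(1/4::real) ^ k = (1/2) ^ k * (1/2) ^ k"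
      by (simp flip: power_mult_distrib)
    also have "\<dots> \<le> (1/2) ^ j * (1/2) ^ k"
      using that by (intro mult_right_mono power_decreasing) auto
    finally have "(1/4) ^ k *\<^sub>R Y k \<le> ((1/2) ^ j * (1/2) ^ k) *\<^sub>R Y k"
      using Y by (intro scaleR_right_mono) auto
    also have "\<dots> \<le> (1/2) ^ j *\<^sub>R p"
      using scaleR_left_mono[OF p[of k], of "(1/2) ^ j"] by simp
    finally have "Y j - w j - (1/2) ^ j *\<^sub>R p \<le> Y j - 0 - (1/4) ^ k *\<^sub>R Y k"
      using w by (intro diff_mono) simp_all
    also have "\<dots> = (1/4) ^ k *\<^sub>R (- ?a)"
      by (simp add: scaleR_diff_right flip: power_mult_distrib)
    finally have zj: "z j \<le> (1/4) ^ k *\<^sub>R pprt (- ?a)"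
      unfolding z_def by (subst pprt_scaleR[symmetric]) (simp_all only: pprt_mono, simp)
    have "inf ((1/4) ^ k *\<^sub>R pprt (- ?a)) (1 *\<^sub>R pprt ?a) = 0"
      using inf_pprt_pprt_minus[of ?a]
      by (intro inf_scaleR_eq_0) (auto simp: inf_commute simp del: minus_diff_eq)
    then have "inf (z j) (z k) \<le> 0"
      using inf_mono[OF zj zk] by simp
    then show ?thesis
      by (intro antisym) (simp_all add: z_def)
  qed
  show ?thesis
  proof (rule that[of r z p])
    show "inf (z i) (z j) = 0" if "i \<noteq> j" for i j
      using that disj[of i j] disj[of j i] by (cases "i < j") (auto simp: inf_commute)
    show "z k \<le> y (r k)" for k
    proof -
      have "Y k - w k - (1/2) ^ k *\<^sub>R p \<le> Y k - 0 - 0"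
        using w p0 by (intro diff_mono) (simp_all add: scaleR_nonneg_nonneg)
      then have "z k \<le> pprt (Y k)"
        by (simp add: z_def)
      then show ?thesis
        using Y[of k] by (simp add: Y_def)
    qed
    show "\<exists>w\<ge>0. Q k w (r k) \<and> pprt (y (r k) - w) \<le> z k + (1/2) ^ k *\<^sub>R p" for k
    proof (intro exI conjI)
      show "Q k (w k) (r k)"
        using r(2) by (simp add: w_def Y_def)
      have "pprt ((Y k - w k - (1/2) ^ k *\<^sub>R p) + (1/2) ^ k *\<^sub>R p) \<le> z k + pprt ((1/2) ^ k *\<^sub>R p)"
        unfolding z_def by (rule pprt_add_le)
      then show "pprt (y (r k) - w k) \<le> z k + (1/2) ^ k *\<^sub>R p"
        using p0 by (simp add: Y_def scaleR_nonneg_nonneg)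
    qed (rule w)
  qed (simp_all add: r(1) z_def)
qed

subsection \<open>Positive operators\<close>

lemma disjoint_seq_nonneg_iff: "disjoint_seq x \<longleftrightarrow> (\<forall>m n. m \<noteq> n \<longrightarrow> inf (x m) (x n) = 0)"
  if "\<And>n. 0 \<le> x n"
  using that by (simp add: disjoint_seq_def)

lemma norm_positive_apply_le:
  "norm (blinfun_apply T x) \<le> norm (blinfun_apply T \<bar>x\<bar>)" if "0 \<le> T"
  for T :: "'a::banach_lattice \<Rightarrow>\<^sub>L 'b::banach_lattice"
proof (rule norm_lattice_mono)
  have "blinfun_apply T x \<le> blinfun_apply T \<bar>x\<bar>" "blinfun_apply T (- x) \<le> blinfun_apply T \<bar>x\<bar>"
    by (intro blinfun_mono that abs_ge_self abs_ge_minus_self)+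
  then show "\<bar>blinfun_apply T x\<bar> \<le> \<bar>blinfun_apply T \<bar>x\<bar>\<bar>"
    using blinfun_nonneg[OF that abs_ge_zero[of x]] by (simp add: blinfun.minus_right abs_leI)
qed

lemma positive_apply_abs_null:
  fixes T :: "'a::banach_lattice \<Rightarrow>\<^sub>L 'b::banach_lattice"
  assumes "0 \<le> T" and null: "(\<lambda>n. blinfun_apply T \<bar>x n\<bar>) \<longlonglongrightarrow> 0"
  shows "(\<lambda>n. norm (blinfun_apply T (x n))) \<longlonglongrightarrow> 0"
proof (rule tendsto_norm_zero, rule Lim_null_comparison)
  show "\<forall>\<^sub>F n in sequentially. norm (blinfun_apply T (x n)) \<le> norm (blinfun_apply T \<bar>x n\<bar>)"
    by (intro always_eventually allI norm_positive_apply_le assms(1))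
qed (rule tendsto_norm_zero[OF null])

lemma positive_compose:
  "0 \<le> f o\<^sub>L T" if "0 \<le> f" "0 \<le> T"
  for T :: "'a::banach_lattice \<Rightarrow>\<^sub>L 'b::banach_lattice" and f :: "'b \<Rightarrow>\<^sub>L 'c::banach_lattice"
  using that by (simp add: zero_le_blinfun_iff)

lemma weak_star_nullI:
  fixes g :: "nat \<Rightarrow> 'a::banach_lattice \<Rightarrow>\<^sub>L real"
  assumes "\<And>v. 0 \<le> v \<Longrightarrow> (\<lambda>n. blinfun_apply (g n) v) \<longlonglongrightarrow> 0"
  shows "weak_star_null g"
  unfolding weak_star_null_def
proof
  fix v :: 'a
  have "pprt v - pprt (- v) = v"
    using prts[of v] by (simp add: pprt_neg)
  then have "blinfun_apply (g n) v = blinfun_apply (g n) (pprt v) - blinfun_apply (g n) (pprt (- v))" for n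
    by (simp flip: blinfun.diff_right)
  then show "(\<lambda>n. blinfun_apply (g n) v) \<longlonglongrightarrow> 0"
    using tendsto_diff[OF assms[of "pprt v"] assms[of "pprt (- v)"]] by simp
qed

text \<open>Each \<open>g k\<close> is the component of a norming functional of \<open>z k\<close>
  on the band of \<open>z k\<close>. At a positive \<open>v\<close> it is, up to
  \<open>(1/2) ^ k\<close>, the value of that functional at a truncation of \<open>v\<close> by a
  multiple of \<open>z k\<close>. These truncations are disjoint and below \<open>v\<close>, hence
  norm null.\<close>

lemma disjoint_norming_functionals:
  fixes z :: "nat \<Rightarrow> 'a::banach_lattice"
  assumes oc: "order_continuous_norm TYPE('a)"
    and z: "\<And>k. 0 \<le> z k" "\<And>i j. i \<noteq> j \<Longrightarrow> inf (z i) (z j) = 0"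
  obtains g :: "nat \<Rightarrow> 'a \<Rightarrow>\<^sub>L real"
    where "\<And>k. 0 \<le> g k" "weak_star_null g" "\<And>k. norm (z k) \<le> blinfun_apply (g k) (z k)"
proof -
  define A where "A k = {t *\<^sub>R z k |t. 0 \<le> t}" for k
  have "\<forall>k. \<exists>f :: 'a \<Rightarrow>\<^sub>L real. 0 \<le> f \<and> norm f \<le> 1 \<and> blinfun_apply f (z k) = norm (z k)"
    using positive_norming_functional[OF z(1)] by metis
  then obtain f :: "nat \<Rightarrow> 'a \<Rightarrow>\<^sub>L real"
    where f: "\<And>k. 0 \<le> f k" "\<And>k. norm (f k) \<le> 1" "\<And>k. blinfun_apply (f k) (z k) = norm (z k)"
    by metis
  have cone: "positive_cone (A k)" for k
  proof (rule positive_coneI)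
    show "0 \<in> A k"
      by (auto simp: A_def intro!: exI[of _ 0])
    show "0 \<le> u" if "u \<in> A k" for u
      using that z(1) by (auto simp: A_def scaleR_nonneg_nonneg)
    show "u + v \<in> A k" if "u \<in> A k" "v \<in> A k" for u v
      using that by (auto simp: A_def simp flip: scaleR_add_left)
    show "c *\<^sub>R u \<in> A k" if "0 < c" "u \<in> A k" for c u
      using that by (auto simp: A_def)
  qed
  have "\<forall>k. \<exists>g. \<forall>y\<ge>0. blinfun_apply g y = band_component (f k) (A k) y"
    using positive_cone.band_functional[OF cone f(1)] by metis
  then obtain g where g: "\<And>k y. 0 \<le> y \<Longrightarrow> blinfun_apply (g k) y = band_component (f k) (A k) y"
    by metis
  have g0: "0 \<le> g k" for k
    using positive_cone.band_component_nonneg[OF cone f(1)] by (simp add: zero_le_blinfun_iff g)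
  have "weak_star_null g"
  proof (rule weak_star_nullI)
    fix v :: 'a assume v: "0 \<le> v"
    have "\<exists>t\<ge>0. blinfun_apply (g k) v - (1/2) ^ k \<le> blinfun_apply (f k) (inf v (t *\<^sub>R z k))" for k
    proof (rule ccontr)
      assume "\<not> ?thesis"
      then have "blinfun_apply (g k) v \<le> blinfun_apply (g k) v - (1/2) ^ k"
        unfolding g[OF v, of k] by (intro positive_cone.band_component_least[OF cone f(1)]) (force simp: A_def)
      moreover have "(0::real) < (1/2) ^ k"
        by (rule zero_less_power) simp
      ultimately show False by linarith
    qed
    then obtain t where t: "\<And>k. 0 \<le> t k"
        "\<And>k. blinfun_apply (g k) v - (1/2) ^ k \<le> blinfun_apply (f k) (inf v (t k *\<^sub>R z k))"
      by metis
    define V where "V k = inf v (t k *\<^sub>R z k)" for k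
    have V0: "0 \<le> V k" for k
      using v t z by (simp add: V_def scaleR_nonneg_nonneg)
    have "V \<longlonglongrightarrow> 0"
    proof (rule order_bounded_disjoint_null[OF oc V0])
      show "V k \<le> v" for k
        by (simp add: V_def)
      show "inf (V i) (V j) = 0" if "i \<noteq> j" for i j
      proof (rule antisym)
        have "inf (V i) (V j) \<le> inf (t i *\<^sub>R z i) (t j *\<^sub>R z j)"
          unfolding V_def by (intro inf_mono) simp_all
        also have "\<dots> = 0"
          using t z that by (intro inf_scaleR_eq_0) auto
        finally show "inf (V i) (V j) \<le> 0" .
      qed (simp add: V0)
    qed
    then have "(\<lambda>k. norm (V k) + (1/2) ^ k) \<longlonglongrightarrow> 0 + 0"
      by (intro tendsto_add tendsto_norm_zero LIMSEQ_power_zero) simp_all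
    then have lim: "(\<lambda>k. norm (V k) + (1/2) ^ k) \<longlonglongrightarrow> 0"
      by simp
    have upper: "blinfun_apply (g k) v \<le> norm (V k) + (1/2) ^ k" for k
    proof -
      have "blinfun_apply (f k) (V k) \<le> norm (f k) * norm (V k)"
        using norm_blinfun[of "f k" "V k"] by simp
      also have "\<dots> \<le> norm (V k)"
        using f(2)[of k] by (simp add: mult_left_le_one_le)
      finally show ?thesis
        using t(2)[of k] by (simp add: V_def)
    qed
    show "(\<lambda>k. blinfun_apply (g k) v) \<longlonglongrightarrow> 0"
      by (rule tendsto_sandwich[OF _ _ tendsto_const lim])
        (simp_all add: upper blinfun_nonneg[OF g0 v])
  qed
  moreover have "norm (z k) \<le> blinfun_apply (g k) (z k)" for k
  proof -
    \<comment> \<open>Taking \<open>z k\<close> itself as the cone element, the truncation of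
      \<open>z k\<close> is \<open>z k\<close>, so nothing of its norm is lost.\<close>
    have "z k \<in> A k"
      by (auto simp: A_def intro!: exI[of _ 1])
    from positive_cone.band_component_upper[OF cone f(1) this, of k "z k"]
    show ?thesis by (simp add: g z(1) f(3))
  qed
  ultimately show ?thesis
    using g0 by (intro that)
qed

lemma positive_disjoint_null:
  fixes T :: "'e::banach_lattice \<Rightarrow>\<^sub>L 'f::banach_lattice"
  assumes ocE: "order_continuous_norm TYPE('e \<Rightarrow>\<^sub>L real)" and ocF: "order_continuous_norm TYPE('f)"
    and T: "0 \<le> T" and dwdp: "disjoint_weak_star_dunford_pettis T"
    and x: "bounded (range x)" "disjoint_seq x" "\<And>n. 0 \<le> x n"
  shows "(\<lambda>n. blinfun_apply T (x n)) \<longlonglongrightarrow> 0"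
proof (rule ccontr)
  define y where "y n = blinfun_apply T (x n)" for n
  assume "\<not> (\<lambda>n. blinfun_apply T (x n)) \<longlonglongrightarrow> 0"
  then obtain e where e: "0 < e" "\<exists>\<^sub>F n in sequentially. e \<le> norm (y n)"
    unfolding y_def by (rule not_null_frequently)
  obtain B where B: "\<And>n. norm (x n) \<le> B"
    using x(1) by (auto simp: bounded_iff)
  have y0: "0 \<le> y n" for n
    unfolding y_def by (intro blinfun_nonneg T x(3))
  have y_bound: "norm (y n) \<le> norm T * B" for n
    unfolding y_def by (rule order_trans[OF norm_blinfun]) (simp add: B mult_left_mono)
  have y_null: "(\<lambda>n. blinfun_apply \<phi> (y n)) \<longlonglongrightarrow> 0" if "0 \<le> \<phi>" for \<phi> :: "'f \<Rightarrow>\<^sub>L real"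
    using disjoint_null_functional[OF ocE positive_compose[OF that T] x(3) _ B] x(2,3)
    by (simp add: disjoint_seq_nonneg_iff y_def)
  have inf_null: "(\<lambda>n. inf (y n) w) \<longlonglongrightarrow> 0" if w: "0 \<le> w" for w
  proof (rule order_bounded_null[OF ocF])
    show "0 \<le> inf (y n) w" "inf (y n) w \<le> w" for n
      using y0 w by simp_all
    show "(\<lambda>n. blinfun_apply \<phi> (inf (y n) w)) \<longlonglongrightarrow> 0" if \<phi>: "0 \<le> \<phi>" for \<phi> :: "'f \<Rightarrow>\<^sub>L real"
    proof (rule tendsto_sandwich[OF _ _ tendsto_const y_null[OF \<phi>]])
      show "\<forall>\<^sub>F n in sequentially. 0 \<le> blinfun_apply \<phi> (inf (y n) w)"
        using y0 w by (intro always_eventually allI blinfun_nonneg[OF \<phi>]) simp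
      show "\<forall>\<^sub>F n in sequentially. blinfun_apply \<phi> (inf (y n) w) \<le> blinfun_apply \<phi> (y n)"
        by (intro always_eventually allI blinfun_mono[OF \<phi>]) simp
    qed
  qed
  \<comment> \<open>Terms of large norm with small truncation at \<open>w\<close> occur infinitely
    often, so nearly all of their norm sits in the excess over \<open>w\<close>.\<close>
  have "\<exists>\<^sub>F n in sequentially. e \<le> norm (y n) \<and> norm (inf (y n) w) < (1/2) ^ k" if "0 \<le> w" for k w
    using e(2) order_tendstoD(2)[OF tendsto_norm_zero[OF inf_null[OF that]], of "(1/2) ^ k"]
    by (intro frequently_eventually_frequently) simp_all
  from almost_disjoint_subsequence[where y = y
      and Q = "\<lambda>k w n. e \<le> norm (y n) \<and> norm (inf (y n) w) < (1/2) ^ k", OF y0 y_bound this]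
  obtain r z p where r: "strict_mono r"
    and z: "\<And>i j. i \<noteq> j \<Longrightarrow> inf (z i) (z j) = 0" "\<And>k. 0 \<le> z k" "\<And>k. z k \<le> y (r k)"
    and zp: "\<And>k. \<exists>w\<ge>0. (e \<le> norm (y (r k)) \<and> norm (inf (y (r k)) w) < (1/2) ^ k) \<and>
      pprt (y (r k) - w) \<le> z k + (1/2) ^ k *\<^sub>R p"
    by blast
  obtain g :: "nat \<Rightarrow> 'f \<Rightarrow>\<^sub>L real"
    where g: "\<And>k. 0 \<le> g k" "weak_star_null g" "\<And>k. norm (z k) \<le> blinfun_apply (g k) (z k)"
    using disjoint_norming_functionals[OF ocF, of z] z by blast
  have "bounded (range (x \<circ> r))"
    using x(1) by (rule bounded_subset) auto
  moreover have "disjoint_seq (x \<circ> r)"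
    using x(2) strict_mono_eq[OF r] by (auto simp: disjoint_seq_def)
  ultimately have "(\<lambda>k. blinfun_apply (g k) (blinfun_apply T ((x \<circ> r) k))) \<longlonglongrightarrow> 0"
    using dwdp g(2) unfolding disjoint_weak_star_dunford_pettis_def by blast
  then have "(\<lambda>k. blinfun_apply (g k) (y (r k))) \<longlonglongrightarrow> 0"
    by (simp add: y_def)
  \<comment> \<open>By positivity of \<open>g k\<close>, its value at \<open>y (r k)\<close> is at
    least its value at \<open>z k\<close>, hence at least \<open>norm (z k)\<close>.\<close>
  then have z_null: "(\<lambda>k. norm (z k)) \<longlonglongrightarrow> 0"
  proof (rule tendsto_sandwich[OF _ _ tendsto_const, rotated 2])
    show "\<forall>\<^sub>F k in sequentially. norm (z k) \<le> blinfun_apply (g k) (y (r k))"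
      by (intro always_eventually allI order_trans[OF g(3) blinfun_mono[OF g(1) z(3)]])
  qed simp
  \<comment> \<open>The term \<open>y (r k)\<close> is its truncation plus its excess; the three
    summands bound the truncation, the disjoint part and the error of disjointification.\<close>
  have "e \<le> (1/2) ^ k + (norm (z k) + (1/2) ^ k * norm p)" for k
  proof -
    obtain w where w: "0 \<le> w" "e \<le> norm (y (r k))" "norm (inf (y (r k)) w) < (1/2) ^ k"
      "pprt (y (r k) - w) \<le> z k + (1/2) ^ k *\<^sub>R p"
      using zp[of k] by auto
    have "y (r k) = inf (y (r k)) w + pprt (y (r k) - w)"
      by (simp add: inf_eq_diff_pprt)
    then have "norm (y (r k)) \<le> norm (inf (y (r k)) w) + norm (pprt (y (r k) - w))"
      by (metis norm_triangle_ineq)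
    also have "norm (pprt (y (r k) - w)) \<le> norm (z k + (1/2) ^ k *\<^sub>R p)"
      by (rule norm_mono[OF zero_le_pprt w(4)])
    also have "\<dots> \<le> norm (z k) + (1/2) ^ k * norm p"
      by (rule order_trans[OF norm_triangle_ineq]) simp
    finally show ?thesis
      using w(2,3) by simp
  qed
  moreover have "(\<lambda>k. (1/2) ^ k + (norm (z k) + (1/2) ^ k * norm p)) \<longlonglongrightarrow> 0 + (0 + 0)"
    by (intro tendsto_add z_null tendsto_mult_left_zero LIMSEQ_power_zero) simp_all
  ultimately have "e \<le> 0"
    by (intro LIMSEQ_le_const[of _ 0]) auto
  with e(1) show False by simp
qed

text \<open>The images of the truncations of \<open>\<bar>x n\<bar>\<close> at \<open>w\<close> are
  below the image of \<open>w\<close> and weakly null, hence norm null. The excesses are dominated,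
  along a subsequence, by disjoint elements plus null multiples of a fixed \<open>p\<close>.\<close>

lemma M_weakly_compact_imp_uaw_dunford_pettis:
  fixes T :: "'e::banach_lattice \<Rightarrow>\<^sub>L 'f::banach_lattice"
  assumes ocF: "order_continuous_norm TYPE('f)" and T: "0 \<le> T" and M: "M_weakly_compact T"
  shows "uaw_dunford_pettis T"
  unfolding uaw_dunford_pettis_def
proof (intro allI impI, elim conjE)
  fix x :: "nat \<Rightarrow> 'e" assume x: "bounded (range x)" "uaw_converges x 0"
  obtain B where B: "\<And>n. norm (x n) \<le> B"
    using x(1) by (auto simp: bounded_iff)
  have inf_null: "(\<lambda>n. blinfun_apply T (inf \<bar>x n\<bar> w)) \<longlonglongrightarrow> 0" if w: "0 \<le> w" for w
  proof (rule order_bounded_null[OF ocF])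
    show "0 \<le> blinfun_apply T (inf \<bar>x n\<bar> w)" "blinfun_apply T (inf \<bar>x n\<bar> w) \<le> blinfun_apply T w" for n
      using w by (simp_all add: blinfun_nonneg[OF T] blinfun_mono[OF T])
    show "(\<lambda>n. blinfun_apply \<phi> (blinfun_apply T (inf \<bar>x n\<bar> w))) \<longlonglongrightarrow> 0" for \<phi> :: "'f \<Rightarrow>\<^sub>L real"
    proof -
      have "weakly_null (\<lambda>n. inf \<bar>x n\<bar> w)"
        using x(2) w by (simp add: uaw_converges_def)
      then have "(\<lambda>n. blinfun_apply (\<phi> o\<^sub>L T) (inf \<bar>x n\<bar> w)) \<longlonglongrightarrow> 0"
        unfolding weakly_null_def by blast
      then show ?thesis by simp
    qed
  qed
  have B': "norm \<bar>x n\<bar> \<le> B" for n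
    using B by simp
  have "(\<lambda>n. blinfun_apply T \<bar>x n\<bar>) \<longlonglongrightarrow> 0"
  proof (rule ccontr)
    assume "\<not> ?thesis"
    then obtain e where e: "0 < e" "\<exists>\<^sub>F n in sequentially. e \<le> norm (blinfun_apply T \<bar>x n\<bar>)"
      by (rule not_null_frequently)
    \<comment> \<open>Since the truncated part eventually has image of norm below
      \<open>e / 2\<close>, the excess keeps at least half of \<open>e\<close>.\<close>
    have "\<exists>\<^sub>F n in sequentially. e / 2 \<le> norm (blinfun_apply T (pprt (\<bar>x n\<bar> - w)))"
      if "0 \<le> w" for w
    proof -
      have "\<forall>\<^sub>F n in sequentially. norm (blinfun_apply T (inf \<bar>x n\<bar> w)) < e / 2"
        using order_tendstoD(2)[OF tendsto_norm_zero[OF inf_null[OF that]], of "e / 2"] e(1) by simp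
      with e(2) have "\<exists>\<^sub>F n in sequentially. e \<le> norm (blinfun_apply T \<bar>x n\<bar>) \<and>
          norm (blinfun_apply T (inf \<bar>x n\<bar> w)) < e / 2"
        by (rule frequently_eventually_frequently)
      then show ?thesis
      proof (rule frequently_elim1)
        fix n assume n: "e \<le> norm (blinfun_apply T \<bar>x n\<bar>) \<and> norm (blinfun_apply T (inf \<bar>x n\<bar> w)) < e / 2"
        have "blinfun_apply T \<bar>x n\<bar> = blinfun_apply T (inf \<bar>x n\<bar> w) + blinfun_apply T (pprt (\<bar>x n\<bar> - w))"
          by (simp add: inf_eq_diff_pprt flip: blinfun.add_right)
        with n show "e / 2 \<le> norm (blinfun_apply T (pprt (\<bar>x n\<bar> - w)))"
          using norm_triangle_ineq[of "blinfun_apply T (inf \<bar>x n\<bar> w)" "blinfun_apply T (pprt (\<bar>x n\<bar> - w))"]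
          by simp
      qed
    qed
    note subseq = almost_disjoint_subsequence[where y = "\<lambda>n. \<bar>x n\<bar>"
        and Q = "\<lambda>k w n. e / 2 \<le> norm (blinfun_apply T (pprt (\<bar>x n\<bar> - w)))", OF abs_ge_zero B' this]
    obtain r :: "nat \<Rightarrow> nat" and z p where "strict_mono r"
      and z: "\<And>i j. i \<noteq> j \<Longrightarrow> inf (z i) (z j) = 0" "\<And>k. 0 \<le> z k" "\<And>k. z k \<le> \<bar>x (r k)\<bar>"
      and zp: "\<And>k. \<exists>w\<ge>0. e / 2 \<le> norm (blinfun_apply T (pprt (\<bar>x (r k)\<bar> - w))) \<and>
        pprt (\<bar>x (r k)\<bar> - w) \<le> z k + (1/2) ^ k *\<^sub>R p"
      by (rule subseq, assumption) (rule that; assumption)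
    have "norm (z k) \<le> B" for k
      using norm_mono[OF z(2,3), of k] B[of "r k"] by simp
    then have "bounded (range z)"
      by (auto simp: bounded_iff)
    moreover have "disjoint_seq z"
      using z by (simp add: disjoint_seq_nonneg_iff)
    ultimately have Tz: "(\<lambda>k. norm (blinfun_apply T (z k))) \<longlonglongrightarrow> 0"
      using M unfolding M_weakly_compact_def by blast
    have "e / 2 \<le> norm (blinfun_apply T (z k)) + (1/2) ^ k * norm (blinfun_apply T p)" for k
    proof -
      obtain w where w: "e / 2 \<le> norm (blinfun_apply T (pprt (\<bar>x (r k)\<bar> - w)))"
        "pprt (\<bar>x (r k)\<bar> - w) \<le> z k + (1/2) ^ k *\<^sub>R p"
        using zp[of k] by auto
      have "norm (blinfun_apply T (pprt (\<bar>x (r k)\<bar> - w))) \<le> norm (blinfun_apply T (z k + (1/2) ^ k *\<^sub>R p))"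
        by (rule norm_mono[OF blinfun_nonneg[OF T zero_le_pprt] blinfun_mono[OF T w(2)]])
      also have "\<dots> \<le> norm (blinfun_apply T (z k)) + norm (blinfun_apply T ((1/2) ^ k *\<^sub>R p))"
        unfolding blinfun.add_right by (rule norm_triangle_ineq)
      finally show ?thesis
        using w(1) by (simp add: blinfun.scaleR_right)
    qed
    moreover have "(\<lambda>k. norm (blinfun_apply T (z k)) + (1/2) ^ k * norm (blinfun_apply T p)) \<longlonglongrightarrow> 0 + 0"
      by (intro tendsto_add Tz tendsto_mult_left_zero LIMSEQ_power_zero) simp_all
    ultimately have "e / 2 \<le> 0"
      by (intro LIMSEQ_le_const[of _ 0]) auto
    with e(1) show False by simp
  qed
  then show "(\<lambda>n. norm (blinfun_apply T (x n))) \<longlonglongrightarrow> 0"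
    by (rule positive_apply_abs_null[OF T])
qed

theorem proposition3p6:
  fixes T :: "'e::banach_lattice \<Rightarrow>\<^sub>L 'f::banach_lattice"
  assumes "order_continuous_norm TYPE('e \<Rightarrow>\<^sub>L real)"
    and "order_continuous_norm TYPE('f)"
    and "0 \<le> T"
    and "disjoint_weak_star_dunford_pettis T"
  shows "M_weakly_compact T \<and> uaw_dunford_pettis T"
proof -
  have "M_weakly_compact T"
    unfolding M_weakly_compact_def
  proof (intro allI impI, elim conjE)
    fix x :: "nat \<Rightarrow> 'e" assume x: "bounded (range x)" "disjoint_seq x"
    \<comment> \<open>Boundedness and disjointness depend only on absolute values, and positivity of
      \<open>T\<close> transfers the conclusion back to \<open>x\<close>.\<close>
    have "bounded (range (\<lambda>n. \<bar>x n\<bar>))" "disjoint_seq (\<lambda>n. \<bar>x n\<bar>)"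
      using x by (auto simp: bounded_iff disjoint_seq_def)
    then have "(\<lambda>n. blinfun_apply T \<bar>x n\<bar>) \<longlonglongrightarrow> 0"
      by (rule positive_disjoint_null[OF assms]) simp
    then show "(\<lambda>n. norm (blinfun_apply T (x n))) \<longlonglongrightarrow> 0"
      by (rule positive_apply_abs_null[OF assms(3)])
  qed
  then show ?thesis
    using M_weakly_compact_imp_uaw_dunford_pettis[OF assms(2,3)] by blast
qed

end
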